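(* Let $\mathbf{S}(n)=\sum_{i=1}^n\mathbf{Y}_i$, $\mathbf{S}(0)=0$, be a random walk in $\mathbb{R}^d$ with i.i.d. steps such that $\mathbb{E}[\|\mathbf{Y}_1\|^2]<\infty$, and let $\mu=\mathbb{E}[\mathbf{Y}_1]$. Then $$\operatorname{Var}\bigl(V_1(\mathrm{conv}\{\mathbf{S}(0),\ldots,\mathbf{S}(n)\})\bigr)\le n\,\mathbb{E}\bigl[\|\mathbf{Y}_1-\mu\|^2\bigr],\qquad n\in\mathbb{N}.$$
   Context: $\mathrm{conv}$ is the convex hull; $\|\cdot\|$ is the Euclidean norm. $V_1$ is the first intrinsic volume: intrinsic volumes $V_0(A),\dots,V_d(A)$ of a convex body $A\subset\mathbb{R}^d$ are defined by the Steiner formula $\mathrm{Vol}_d(A+\rho B^d)=\sum_{m=0}^d\rho^{d-m}\kappa_{d-m}V_m(A)$, $\rho\ge0$, where $B^d$ is the closed unit ball and $\kappa_d=\mathrm{Vol}_d(B^d)$. Equivalently $V_1(A)=\frac1{\kappa_{d-1}}\int_{\mathbb{S}^{d-1}}s_A(\theta)\,\sigma(\mathrm{d}\theta)$ with $s_A(\theta)=\sup_{y\in A}\langle\theta,y\rangle$ and $\sigma$ the surface measure on the unit sphere. *)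

theory Defs
  imports "HOL-Probability.Probability" "HOL-Library.Set_Algebras"
begin

text \<open>
  \<open>V 0, \<dots>, V d\<close> are the coefficients in the Steiner formula of \<open>A\<close>, where \<open>d = DIM('a)\<close>.
  The set on the left-hand side is the Minkowski sum of \<open>A\<close> and the unit ball dilated by \<open>\<rho>\<close>, and
  \<open>unit_ball_vol k\<close> is the volume of the unit ball in dimension \<open>k\<close>.
\<close>

definition steiner_coefficients :: "'a::euclidean_space set \<Rightarrow> (nat \<Rightarrow> real) \<Rightarrow> bool" where
  "steiner_coefficients A V \<longleftrightarrow>
     (\<forall>\<rho>\<ge>0. measure lborel (A + (\<lambda>x. \<rho> *\<^sub>R x) ` cball 0 1) =
        (\<Sum>m=0..DIM('a). \<rho> ^ (DIM('a) - m) * unit_ball_vol (real (DIM('a) - m)) * V m))"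

text \<open>
  For a convex body \<open>A\<close> (nonempty, compact, convex) the coefficients exist by Steiner's theorem.
  The values \<open>V m\<close> with \<open>m \<le> DIM('a)\<close> are unique because a polynomial is determined by its
  values on \<open>\<rho> \<ge> 0\<close> and \<open>unit_ball_vol\<close> is positive. For \<open>m > DIM('a)\<close> the value is unspecified.
\<close>

definition intrinsic_volume :: "nat \<Rightarrow> 'a::euclidean_space set \<Rightarrow> real" where
  "intrinsic_volume m A = (THE v. \<exists>V. steiner_coefficients A V \<and> V m = v)"

definition walk :: "(nat \<Rightarrow> 'w \<Rightarrow> 'a::euclidean_space) \<Rightarrow> nat \<Rightarrow> 'w \<Rightarrow> 'a" where
  "walk Y k \<omega> = (\<Sum>i=1..k. Y i \<omega>)"

end

theory Submission
  imports Defs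
begin

text \<open>
  For a polytope \<open>K = convex hull P\<close>, sort the points \<open>z\<close> of \<open>K + \<rho> B\<close> by the set \<open>A\<close> of vertices
  that maximise the direction from the nearest point of \<open>K\<close> to \<open>z\<close>. Each class is the sum of a
  face and a truncated cone orthogonal to it, so its volume is a monomial in \<open>\<rho>\<close>; this
  gives Steiner's formula. Reading \<open>V\<^sub>1\<close> off as the second coefficient for \<open>\<rho> \<rightarrow> \<infinity>\<close> shows that it is
  monotone, and that adding a segment of length \<open>l\<close> increases it by at most \<open>l\<close>, since the volume of
  \<open>K + \<rho> B\<close> then grows by at most \<open>l\<close> times the volume of its shadow. Changing one step of the walk
  by \<open>u\<close> moves some of the points \<open>S(k)\<close> by \<open>u\<close> and fixes the others, so \<open>V\<^sub>1\<close> changes by at most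
  \<open>norm u\<close>. Integrating out one step preserves this Lipschitz property in the other steps, and the
  conditional variance given the others is at most the expectation of \<open>(norm (Y - \<mu>))\<^sup>2\<close>; induction on
  the number of steps gives the bound.
\<close>

section \<open>Orthogonal invariance and scaling of Lebesgue measure\<close>

text \<open>
  The Fubini argument for the uniqueness of translation-invariant measures; the constant is 1 because
  the unit ball is preserved. The library proves this only for \<open>real ^ 'n\<close>.
\<close>

lemma lborel_distr_orthogonal_transformation:
  fixes f :: "'a::euclidean_space \<Rightarrow> 'a"
  assumes f: "orthogonal_transformation f"
  shows "distr lborel borel f = lborel"
proof (rule measure_eqI)
  define g where "g = inv f"
  have fg: "f (g x) = x" for x
    unfolding g_def using orthogonal_transformation_surj[OF f] by (simp add: surj_f_inv_f)
  have lf: "linear f" using f by (rule orthogonal_transformation_linear)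
  have [measurable]: "cball (0::'a) 1 \<in> sets borel" by simp
  have [measurable]: "f \<in> borel_measurable borel"
    using lf by (intro borel_measurable_continuous_onI linear_continuous_on linear_conv_bounded_linear[THEN iffD1])
  fix A assume "A \<in> sets (distr lborel borel f)"
  then have [measurable]: "A \<in> sets borel" by simp
  let ?B = "cball (0::'a) 1"
  let ?k = "ennreal (unit_ball_vol DIM('a))"
  have shift: "(\<integral>\<^sup>+x. h (c + x) \<partial>lborel) = (\<integral>\<^sup>+x. h x \<partial>lborel)"
    if [measurable]: "h \<in> borel_measurable borel" for h :: "'a \<Rightarrow> ennreal" and c
    by (subst lborel_distr_plus[of c, symmetric]) (simp add: nn_integral_distr)
  have ball: "emeasure lborel ?B = ?k"
    by (simp add: emeasure_cball)
  have "emeasure (distr lborel borel f) A * ?k = (\<integral>\<^sup>+x. indicator A (f x) \<partial>lborel) * ?k"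
    by (simp add: nn_integral_indicator[symmetric] nn_integral_distr del: nn_integral_indicator)
  also have "\<dots> = (\<integral>\<^sup>+y. (\<integral>\<^sup>+x. indicator A (f x) \<partial>lborel) * indicator ?B y \<partial>lborel)"
    by (subst nn_integral_cmult_indicator) (simp_all add: ball)
  \<comment> \<open>For fixed \<open>y\<close>, translate \<open>x\<close> by \<open>g y\<close>.
    Since \<open>f (g y) = y\<close>, this turns \<open>f x\<close> into \<open>f x + y\<close>, and
    after exchanging the integrals \<open>y\<close> can be translated by \<open>f x\<close>.\<close>
  also have "\<dots> = (\<integral>\<^sup>+y. (\<integral>\<^sup>+x. indicator A (f (g y + x)) \<partial>lborel) * indicator ?B y \<partial>lborel)"
    by (subst shift[where h="\<lambda>x. indicator A (f x)"]) simp_all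
  also have "\<dots> = (\<integral>\<^sup>+y. (\<integral>\<^sup>+x. indicator A (f x + y) * indicator ?B y \<partial>lborel) \<partial>lborel)"
    by (subst nn_integral_multc[symmetric]) (simp_all add: linear_add[OF lf] fg add.commute)
  also have "\<dots> = (\<integral>\<^sup>+x. (\<integral>\<^sup>+y. indicator A (f x + y) * indicator ?B y \<partial>lborel) \<partial>lborel)"
    by (rule lborel_pair.Fubini') measurable
  also have "\<dots> = (\<integral>\<^sup>+x. (\<integral>\<^sup>+y. indicator A y * indicator ?B (y - f x) \<partial>lborel) \<partial>lborel)"
  proof (rule nn_integral_cong)
    fix x :: 'a
    show "(\<integral>\<^sup>+y. indicator A (f x + y) * indicator ?B y \<partial>lborel) =
        (\<integral>\<^sup>+y. indicator A y * indicator ?B (y - f x) \<partial>lborel :: ennreal)"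
      using shift[where c="f x" and h="\<lambda>y. indicator A y * indicator ?B (y - f x)"] by simp
  qed
  also have "\<dots> = (\<integral>\<^sup>+y. (\<integral>\<^sup>+x. indicator A y * indicator ?B (y - f x) \<partial>lborel) \<partial>lborel)"
    by (rule lborel_pair.Fubini') measurable
  \<comment> \<open>As \<open>f\<close> is an isometry, \<open>y - f x\<close> lies in the unit ball
    iff \<open>x\<close> is within distance 1 of \<open>g y\<close>. The inner integral is then the
    volume of a unit ball, whatever \<open>y\<close> is.\<close>
  also have "\<dots> = (\<integral>\<^sup>+y. (\<integral>\<^sup>+x. indicator A y * indicator (cball (g y) 1) x \<partial>lborel) \<partial>lborel)"
  proof (intro nn_integral_cong)
    fix x y :: 'a
    have "norm (y - f x) = norm (f (g y - x))"
      by (simp add: linear_diff[OF lf] fg)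
    also have "\<dots> = dist (g y) x"
      using f by (simp add: orthogonal_transformation_norm dist_norm)
    finally show "indicator A y * indicator ?B (y - f x) = (indicator A y * indicator (cball (g y) 1) x :: ennreal)"
      by (simp add: indicator_def)
  qed
  also have "\<dots> = (\<integral>\<^sup>+y. indicator A y * ?k \<partial>lborel)"
    by (subst nn_integral_cmult) (simp_all add: emeasure_cball borel_measurable_indicator)
  also have "\<dots> = emeasure lborel A * ?k"
    by (subst nn_integral_multc) simp_all
  finally show "emeasure (distr lborel borel f) A = emeasure lborel A"
    using less_imp_neq[OF unit_ball_vol_pos[of "real DIM('a)"]]
    by (simp add: mult.commute[of _ ?k] ennreal_mult_cancel_left)
qed simp

text \<open>The reflection in the hyperplane orthogonal to \<open>a - b\<close> sends
  \<open>a\<close> to \<open>b\<close>, because equal norms give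
  \<open>2 * (a \<bullet> w) = w \<bullet> w\<close> for \<open>w = a - b\<close>.\<close>

lemma orthogonal_transformation_exists_euclidean:
  fixes a b :: "'a::euclidean_space"
  assumes "norm a = norm b"
  obtains f where "orthogonal_transformation f" "f a = b"
proof (cases "a = b")
  case True
  with that[of "\<lambda>x. x"] show ?thesis by (simp add: orthogonal_transformation_id)
next
  case False
  define w where "w = a - b"
  have w: "w \<bullet> w \<noteq> 0" using False by (simp add: w_def)
  define f where "f x = x - (2 * (x \<bullet> w) / (w \<bullet> w)) *\<^sub>R w" for x
  have "f x \<bullet> f y = x \<bullet> y" for x y
    using w by (simp add: f_def inner_diff_left inner_diff_right inner_commute field_simps)
  moreover have "linear f"
    by (rule linearI) (simp_all add: f_def inner_add_left algebra_simps add_divide_distrib)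
  ultimately have "orthogonal_transformation f"
    by (simp add: orthogonal_transformation_def)
  moreover have "2 * (a \<bullet> w) = w \<bullet> w"
    using assms by (simp add: w_def inner_diff_left inner_diff_right inner_commute norm_eq)
  then have "f a = b" using w by (simp add: f_def w_def)
  ultimately show ?thesis by (rule that)
qed

text \<open>The map multiplies the coordinate along \<open>e\<close> by \<open>c\<close> and keeps
  the others, so this is the change of variables for a diagonal map with determinant
  \<open>c\<close>.\<close>

lemma emeasure_lborel_scale_Basis:
  fixes e :: "'a::euclidean_space"
  assumes e: "e \<in> Basis" and c: "c > 0" and [measurable]: "S \<in> sets borel"
  shows "emeasure lborel S = ennreal c * emeasure lborel ((\<lambda>x. x + ((c - 1) * (x \<bullet> e)) *\<^sub>R e) -` S)"
proof -
  let ?c = "\<lambda>j::'a. if j = e then c else 1"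
  have *: "0 + (\<Sum>j\<in>Basis. (?c j * (x \<bullet> j)) *\<^sub>R j) = x + ((c - 1) * (x \<bullet> e)) *\<^sub>R e" for x
  proof -
    have "(\<Sum>j\<in>Basis. (?c j * (x \<bullet> j)) *\<^sub>R j) =
      (\<Sum>j\<in>Basis. (x \<bullet> j) *\<^sub>R j + (if j = e then ((c - 1) * (x \<bullet> e)) *\<^sub>R e else 0))"
      by (intro sum.cong) (auto simp: algebra_simps)
    also have "\<dots> = x + ((c - 1) * (x \<bullet> e)) *\<^sub>R e"
      using e by (simp add: sum.distrib euclidean_representation)
    finally show ?thesis by simp
  qed
  have p: "(\<Prod>j\<in>Basis. \<bar>?c j\<bar>) = c"
    using e c by (simp add: if_distrib[of abs] prod.delta cong: if_cong)
  have "emeasure lborel S = emeasure (density (distr lborel borel (\<lambda>x. x + ((c - 1) * (x \<bullet> e)) *\<^sub>R e)) (\<lambda>_. ennreal c)) S"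
    using lborel_affine_euclidean[of ?c 0] c unfolding * p by simp
  also have "\<dots> = ennreal c * emeasure lborel ((\<lambda>x. x + ((c - 1) * (x \<bullet> e)) *\<^sub>R e) -` S)"
    by (simp add: emeasure_density nn_integral_cmult_indicator emeasure_distr)
  finally show ?thesis .
qed

text \<open>Conjugating by an orthogonal map that sends a basis vector to \<open>u\<close> reduces
  this to the stretch of one coordinate.\<close>

lemma emeasure_lborel_scale_unit:
  fixes u :: "'a::euclidean_space"
  assumes u: "norm u = 1" and c: "c > 0" and [measurable]: "S \<in> sets borel"
  shows "emeasure lborel S = ennreal c * emeasure lborel ((\<lambda>x. x + ((c - 1) * (x \<bullet> u)) *\<^sub>R u) -` S)"
proof -
  obtain e :: 'a where e: "e \<in> Basis" using nonempty_Basis by blast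
  obtain f where f: "orthogonal_transformation f" "f e = u"
    using orthogonal_transformation_exists_euclidean[of e u] u e by auto
  have lf: "linear f" using f by (simp add: orthogonal_transformation_linear)
  have [measurable]: "f \<in> borel_measurable borel"
    using lf by (intro borel_measurable_continuous_onI linear_continuous_on linear_conv_bounded_linear[THEN iffD1])
  have inv: "emeasure lborel T = emeasure lborel (f -` T)" if [measurable]: "T \<in> sets borel" for T
    by (subst lborel_distr_orthogonal_transformation[OF f(1), symmetric]) (simp add: emeasure_distr)
  have [simp]: "f x \<bullet> u = x \<bullet> e" for x
    using f orthogonal_transformation_def by metis
  have "emeasure lborel S = emeasure lborel (f -` S)"
    by (rule inv) simp
  also have "\<dots> = ennreal c * emeasure lborel ((\<lambda>x. x + ((c - 1) * (x \<bullet> e)) *\<^sub>R e) -` f -` S)"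
    by (intro emeasure_lborel_scale_Basis e c measurable_sets_borel[of f borel]) simp_all
  also have "(\<lambda>x. x + ((c - 1) * (x \<bullet> e)) *\<^sub>R e) -` f -` S = f -` (\<lambda>x. x + ((c - 1) * (x \<bullet> u)) *\<^sub>R u) -` S"
    by (auto simp: linear_add[OF lf] linear_scale[OF lf] f(2))
  also have "emeasure lborel \<dots> = emeasure lborel ((\<lambda>x. x + ((c - 1) * (x \<bullet> u)) *\<^sub>R u) -` S)"
    by (rule inv[symmetric], rule measurable_sets_borel[of _ borel]) simp_all
  finally show ?thesis .
qed

text \<open>Stretching \<open>span B\<close> by \<open>c\<close> is the composition of the stretches
  along the single vectors, each contributing a factor \<open>c\<close>. They compose in this way
  because, by orthogonality, stretching along \<open>B\<close> leaves the component along a further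
  vector \<open>u\<close> unchanged.\<close>

lemma emeasure_lborel_scale_orthonormal:
  fixes B :: "'a::euclidean_space set"
  assumes "finite B" "pairwise orthogonal B" "\<And>b. b \<in> B \<Longrightarrow> norm b = 1"
    and c: "c > 0" and "S \<in> sets borel"
  shows "emeasure lborel S = ennreal (c ^ card B) *
    emeasure lborel ((\<lambda>x. x + (c - 1) *\<^sub>R (\<Sum>b\<in>B. (x \<bullet> b) *\<^sub>R b)) -` S)"
  using assms(1-3,5)
proof (induction B arbitrary: S)
  case empty
  then show ?case by (simp add: vimage_def)
next
  case (insert u B S)
  note [measurable] = insert.prems(3)
  let ?T = "\<lambda>x. x + (c - 1) *\<^sub>R (\<Sum>b\<in>B. (x \<bullet> b) *\<^sub>R b)"
  let ?U = "\<lambda>x. x + ((c - 1) * (x \<bullet> u)) *\<^sub>R u"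
  have "b \<bullet> u = 0" if "b \<in> B" for b
    using insert.prems(1) insert.hyps(2) that unfolding pairwise_def orthogonal_def by fastforce
  then have *: "?T x \<bullet> u = x \<bullet> u" for x
    by (simp add: inner_add_left inner_sum_left)
  have UT: "?U (?T x) = x + (c - 1) *\<^sub>R (\<Sum>b\<in>insert u B. (x \<bullet> b) *\<^sub>R b)" for x
    unfolding * using insert.hyps by (simp add: algebra_simps)
  have eq: "?T -` ?U -` S = (\<lambda>x. x + (c - 1) *\<^sub>R (\<Sum>b\<in>insert u B. (x \<bullet> b) *\<^sub>R b)) -` S"
    unfolding vimage_def mem_Collect_eq UT by (rule refl)
  have "emeasure lborel S = ennreal c * emeasure lborel (?U -` S)"
    using insert.prems c by (intro emeasure_lborel_scale_unit) auto
  also have "?U -` S \<in> sets borel"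
    by (rule measurable_sets_borel[of _ borel]) simp_all
  then have "emeasure lborel (?U -` S) = ennreal (c ^ card B) * emeasure lborel (?T -` ?U -` S)"
    using insert.prems by (intro insert.IH) (auto simp: pairwise_insert)
  finally show ?case
    using c insert.hyps by (simp add: eq ennreal_mult mult.assoc)
qed

text \<open>Conjugation by a translation moves the centre of the stretch to \<open>a\<close>. For
  the normal regions below, \<open>a\<close> is a point of \<open>A\<close>.\<close>

corollary emeasure_lborel_scale_orthonormal_about:
  fixes B :: "'a::euclidean_space set"
  assumes "finite B" "pairwise orthogonal B" "\<And>b. b \<in> B \<Longrightarrow> norm b = 1"
    and c: "c > 0" and [measurable]: "S \<in> sets borel"
  shows "emeasure lborel S = ennreal (c ^ card B) *
    emeasure lborel ((\<lambda>x. x + (c - 1) *\<^sub>R (\<Sum>b\<in>B. ((x - a) \<bullet> b) *\<^sub>R b)) -` S)"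
proof -
  let ?T = "\<lambda>x. x + (c - 1) *\<^sub>R (\<Sum>b\<in>B. (x \<bullet> b) *\<^sub>R b)"
  let ?U = "\<lambda>x. x + (c - 1) *\<^sub>R (\<Sum>b\<in>B. ((x - a) \<bullet> b) *\<^sub>R b)"
  have shift: "emeasure lborel X = emeasure lborel ((+) a -` X)" if [measurable]: "X \<in> sets borel" for X
    by (subst lborel_distr_plus[of a, symmetric]) (simp add: emeasure_distr)
  have "emeasure lborel S = emeasure lborel ((+) a -` S)"
    by (rule shift) simp
  also have "\<dots> = ennreal (c ^ card B) * emeasure lborel (?T -` (+) a -` S)"
    using assms by (intro emeasure_lborel_scale_orthonormal measurable_sets_borel[of _ borel]) simp_all
  also have "?T -` (+) a -` S = (+) a -` ?U -` S"
    by (auto simp: add_ac)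
  also have "emeasure lborel \<dots> = emeasure lborel (?U -` S)"
    by (rule shift[symmetric], rule measurable_sets_borel[of _ borel]) simp_all
  finally show ?thesis .
qed

section \<open>Adding a segment to a convex body\<close>

text \<open>Lebesgue measure is a product over \<open>Basis\<close>. Splitting off the factor of
  \<open>e\<close> integrates along the lines parallel to \<open>e\<close>, on which adding a
  segment in direction \<open>e\<close> can be measured.\<close>

lemma emeasure_lborel_Fubini_Basis:
  fixes e :: "'a::euclidean_space"
  assumes e: "e \<in> Basis" and [measurable]: "S \<in> sets borel"
  shows "emeasure lborel S = (\<integral>\<^sup>+x. (\<integral>\<^sup>+y. indicator S ((\<Sum>b\<in>Basis - {e}. x b *\<^sub>R b) + y *\<^sub>R e) \<partial>lborel)
    \<partial>Pi\<^sub>M (Basis - {e}) (\<lambda>_. lborel))"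
proof -
  interpret product_sigma_finite "\<lambda>_::'a. lborel :: real measure" by standard
  let ?D = "Basis - {e}"
  have B: "insert e ?D = Basis" using e by auto
  have *: "emeasure lborel S = (\<integral>\<^sup>+x. (\<integral>\<^sup>+y. indicator S (\<Sum>b\<in>Basis. (x(e := y)) b *\<^sub>R b) \<partial>lborel) \<partial>Pi\<^sub>M ?D (\<lambda>_. lborel))"
  proof -
    have "emeasure lborel S = (\<integral>\<^sup>+x. indicator S (\<Sum>b\<in>Basis. x b *\<^sub>R b) \<partial>Pi\<^sub>M (insert e ?D) (\<lambda>_. lborel))"
      unfolding B by (subst lborel_eq) (simp add: nn_integral_indicator[symmetric] nn_integral_distr del: nn_integral_indicator)
    also have "\<dots> = (\<integral>\<^sup>+x. (\<integral>\<^sup>+y. indicator S (\<Sum>b\<in>Basis. (x(e := y)) b *\<^sub>R b) \<partial>lborel) \<partial>Pi\<^sub>M ?D (\<lambda>_. lborel))"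
      by (rule product_nn_integral_insert) (simp_all add: B)
    finally show ?thesis .
  qed
  have eq: "(\<Sum>b\<in>Basis. (x(e := y)) b *\<^sub>R b) = (\<Sum>b\<in>?D. x b *\<^sub>R b) + y *\<^sub>R e" for x :: "'a \<Rightarrow> real" and y
  proof -
    have "(\<Sum>b\<in>Basis. (x(e := y)) b *\<^sub>R b) = y *\<^sub>R e + (\<Sum>b\<in>?D. (x(e := y)) b *\<^sub>R b)"
      using e by (subst sum.remove[of _ e]) simp_all
    also have "(\<Sum>b\<in>?D. (x(e := y)) b *\<^sub>R b) = (\<Sum>b\<in>?D. x b *\<^sub>R b)"
      by (intro sum.cong) auto
    finally show ?thesis by simp
  qed
  show ?thesis unfolding * eq ..
qed

text \<open>Cavalieri's principle along the lines parallel to \<open>e\<close>. By convexity such a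
  line meets \<open>C\<close> in an interval, which the segment lengthens by at most
  \<open>t\<close>; a line that misses \<open>C\<close> also misses the sum. The lines that meet
  \<open>C\<close> have their base points in the shadow of \<open>cball 0 r\<close>, a ball of
  dimension \<open>DIM('a) - 1\<close>.\<close>

lemma emeasure_plus_segment_Basis:
  fixes e :: "'a::euclidean_space"
  assumes e: "e \<in> Basis" and C: "compact C" "convex C" "C \<subseteq> cball 0 r" and r: "r > 0" and t: "t \<ge> 0"
  shows "emeasure lborel (C + (\<lambda>s. s *\<^sub>R e) ` {0..t}) \<le>
     emeasure lborel C + ennreal (t * (unit_ball_vol (real (DIM('a) - 1)) * r ^ (DIM('a) - 1)))"
proof -
  let ?D = "Basis - {e}" and ?S = "C + (\<lambda>s. s *\<^sub>R e) ` {0..t}"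
  let ?p = "\<lambda>x. \<Sum>b\<in>?D. x b *\<^sub>R b"
  let ?M = "Pi\<^sub>M ?D (\<lambda>_. lborel :: real measure)"
  let ?R = "{x. sqrt (\<Sum>b\<in>?D. (x b)\<^sup>2) \<le> r} \<inter> space ?M"
  have [measurable]: "C \<in> sets borel" using C by (simp add: borel_compact)
  have "compact ?S"
    unfolding set_plus_image
    by (intro compact_continuous_image compact_Times C) (auto intro!: continuous_intros compact_continuous_image simp: case_prod_beta)
  then have [measurable]: "?S \<in> sets borel" by (simp add: borel_compact)
  have slice: "(\<integral>\<^sup>+y. indicator ?S (?p x + y *\<^sub>R e) \<partial>lborel) \<le>
      (\<integral>\<^sup>+y. indicator C (?p x + y *\<^sub>R e) \<partial>lborel) + ennreal t * indicator ?R x"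
    if x: "x \<in> space ?M" for x
  proof -
    let ?I = "{y. ?p x + y *\<^sub>R e \<in> C}"
    \<comment> \<open>The squared coordinates of a point of \<open>C\<close> sum to at most the
      square of \<open>r\<close>. This places the base point \<open>x\<close> in the shadow and also
      bounds the slice \<open>?I\<close>.\<close>
    have norm: "x \<in> ?R \<and> \<bar>y\<bar> \<le> r" if "y \<in> ?I" for y
    proof -
      let ?z = "?p x + y *\<^sub>R e"
      have zb: "?z \<bullet> b = (if b = e then y else x b)" if "b \<in> Basis" for b
        using that e by (auto simp: inner_add_left inner_sum_left inner_Basis if_distrib sum.delta cong: if_cong)
      have "(\<Sum>b\<in>?D. (x b)\<^sup>2) + y\<^sup>2 = (\<Sum>b\<in>Basis. (?z \<bullet> b)\<^sup>2)"
        using e by (subst sum.remove[of _ e]) (auto simp: zb intro!: sum.cong)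
      also have "\<dots> = (norm ?z)\<^sup>2"
        by (subst power2_norm_eq_inner, subst euclidean_inner) (simp add: power2_eq_square)
      also have "\<dots> \<le> r\<^sup>2"
        using that C(3) by (intro power_mono) auto
      finally have le: "(\<Sum>b\<in>?D. (x b)\<^sup>2) + y\<^sup>2 \<le> r\<^sup>2" .
      have "0 \<le> (\<Sum>b\<in>?D. (x b)\<^sup>2)" by (intro sum_nonneg) auto
      with le have "y\<^sup>2 \<le> r\<^sup>2" "(\<Sum>b\<in>?D. (x b)\<^sup>2) \<le> r\<^sup>2" by (auto simp: add_increasing2 intro: order_trans[rotated])
      then show ?thesis using r x abs_le_square_iff[of y r] by (auto intro: real_le_lsqrt)
    qed
    have I_eq: "?I = (\<lambda>y. ?p x + y *\<^sub>R e) -` C" by auto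
    have "closed ?I"
      unfolding I_eq using C by (intro closed_vimage compact_imp_closed continuous_intros)
    moreover have "bounded ?I"
      using norm by (intro boundedI[of _ r]) auto
    moreover have "convex ?I"
    proof (rule convexI)
      fix y z u v :: real assume *: "y \<in> ?I" "z \<in> ?I" "0 \<le> u" "0 \<le> v" "u + v = 1"
      have "?p x + (u *\<^sub>R y + v *\<^sub>R z) *\<^sub>R e = (u + v) *\<^sub>R ?p x + (u *\<^sub>R y + v *\<^sub>R z) *\<^sub>R e"
        using *(5) by simp
      also have "\<dots> = u *\<^sub>R (?p x + y *\<^sub>R e) + v *\<^sub>R (?p x + z *\<^sub>R e)"
        by (simp add: algebra_simps)
      also have "\<dots> \<in> C" using * C(2) by (intro convexD) auto
      finally show "u *\<^sub>R y + v *\<^sub>R z \<in> ?I" by simp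
    qed
    ultimately have "connected ?I \<and> compact ?I"
      by (simp add: convex_connected compact_eq_bounded_closed)
    then obtain a b where ab: "?I = {a..b}"
      using connected_compact_interval_1 by blast
    show ?thesis
    proof (cases "?I = {}")
      case True
      have "?p x + y *\<^sub>R e \<notin> ?S" for y
      proof
        assume "?p x + y *\<^sub>R e \<in> ?S"
        then obtain c s where "?p x + y *\<^sub>R e = c + s *\<^sub>R e" "c \<in> C"
          by (auto elim!: set_plus_elim)
        then have "y - s \<in> ?I" by (simp add: algebra_simps)
        then show False using True by blast
      qed
      then show ?thesis by simp
    next
      case False
      with ab have le: "a \<le> b" by auto
      have "x \<in> ?R" using norm False by blast
      have "y \<in> {a..b + t}" if "?p x + y *\<^sub>R e \<in> ?S" for y
      proof -
        obtain c s where *: "?p x + y *\<^sub>R e = c + s *\<^sub>R e" "c \<in> C" "0 \<le> s" "s \<le> t"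
          using \<open>?p x + y *\<^sub>R e \<in> ?S\<close> by (auto elim!: set_plus_elim)
        then have "y - s \<in> ?I" by (simp add: algebra_simps)
        then show ?thesis using * unfolding ab by auto
      qed
      then have "(\<integral>\<^sup>+y. indicator ?S (?p x + y *\<^sub>R e) \<partial>lborel) \<le> (\<integral>\<^sup>+y. indicator {a..b+t} y \<partial>lborel)"
        by (intro nn_integral_mono) (auto simp: indicator_def)
      also have "\<dots> = ennreal (b - a) + ennreal t"
        using le t by (simp add: ennreal_plus[symmetric] del: ennreal_plus)
      also have "ennreal (b - a) = (\<integral>\<^sup>+y. indicator {a..b} y \<partial>lborel)"
        using le by simp
      also have "\<dots> = (\<integral>\<^sup>+y. indicator C (?p x + y *\<^sub>R e) \<partial>lborel)"
        unfolding ab[symmetric] by (simp add: indicator_def)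
      finally show ?thesis using \<open>x \<in> ?R\<close> by simp
    qed
  qed
  have "emeasure lborel ?S = (\<integral>\<^sup>+x. (\<integral>\<^sup>+y. indicator ?S (?p x + y *\<^sub>R e) \<partial>lborel) \<partial>?M)"
    by (rule emeasure_lborel_Fubini_Basis[OF e]) simp
  also have "\<dots> \<le> (\<integral>\<^sup>+x. (\<integral>\<^sup>+y. indicator C (?p x + y *\<^sub>R e) \<partial>lborel) + ennreal t * indicator ?R x \<partial>?M)"
    by (intro nn_integral_mono slice)
  also have "\<dots> = (\<integral>\<^sup>+x. (\<integral>\<^sup>+y. indicator C (?p x + y *\<^sub>R e) \<partial>lborel) \<partial>?M) + (\<integral>\<^sup>+x. ennreal t * indicator ?R x \<partial>?M)"
    by (rule nn_integral_add) measurable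
  also have "(\<integral>\<^sup>+x. (\<integral>\<^sup>+y. indicator C (?p x + y *\<^sub>R e) \<partial>lborel) \<partial>?M) = emeasure lborel C"
    by (rule emeasure_lborel_Fubini_Basis[OF e, symmetric]) simp
  also have "(\<integral>\<^sup>+x. ennreal t * indicator ?R x \<partial>?M) = ennreal t * emeasure ?M ?R"
    by (rule nn_integral_cmult_indicator) measurable
  also have "emeasure ?M ?R = ennreal (unit_ball_vol (real (DIM('a) - 1)) * r ^ (DIM('a) - 1))"
    using e r by (subst emeasure_cball_aux) (simp_all add: card_Diff_singleton)
  finally show ?thesis using t r by (simp add: ennreal_mult)
qed

section \<open>Steiner's formula for polytopes\<close>

lemma scaleR_image_cball:
  fixes \<rho> :: real
  assumes "\<rho> \<ge> 0"
  shows "(\<lambda>x. \<rho> *\<^sub>R x) ` cball (0::'a::real_normed_vector) 1 = cball 0 \<rho>"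
  using cball_scale[of \<rho> "0::'a" 1] assms by (cases "\<rho> = 0") (auto simp: image_constant_conv)

text \<open>
  The vectors \<open>v\<close> for which \<open>A\<close> is the set of maximisers of \<open>v \<bullet> _\<close> on \<open>P\<close>, i.e. the relatively
  open normal cone of the exposed face \<open>convex hull A\<close>. For \<open>P\<close> finite and nonempty these cones
  partition the space, so the face lattice of the polytope is not needed.
\<close>

definition exposing_normals :: "'a::euclidean_space set \<Rightarrow> 'a set \<Rightarrow> 'a set" where
  "exposing_normals P A = {v. A = {q \<in> P. \<forall>p\<in>P. v \<bullet> p \<le> v \<bullet> q}}"

text \<open>For \<open>P\<close> finite and nonempty this is the sum of the face
  \<open>convex hull A\<close> and the truncated cone
  \<open>exposing_normals P A \<inter> cball 0 \<rho>\<close>. Defining it through the nearest point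
  makes the regions of different \<open>A\<close> disjoint at once, and Borel because
  \<open>closest_point\<close> is continuous.\<close>

definition normal_region :: "'a::euclidean_space set \<Rightarrow> 'a set \<Rightarrow> real \<Rightarrow> 'a set" where
  "normal_region P A \<rho> =
    {z. z - closest_point (convex hull P) z \<in> exposing_normals P A \<inter> cball 0 \<rho>}"

lemma scaleR_in_exposing_normals:
  assumes "v \<in> exposing_normals P A" "c > 0"
  shows "c *\<^sub>R v \<in> exposing_normals P A"
  using assms by (auto simp: exposing_normals_def)

lemma sets_exposing_normals [measurable]:
  assumes P: "finite P"
  shows "exposing_normals P A \<in> sets borel"
proof (cases "A \<subseteq> P")
  case True
  then have "exposing_normals P A = {v. \<forall>q\<in>P. q \<in> A \<longleftrightarrow> (\<forall>p\<in>P. v \<bullet> p \<le> v \<bullet> q)}"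
    by (auto simp: exposing_normals_def)
  also have "Measurable.pred borel (\<lambda>v. \<forall>q\<in>P. q \<in> A \<longleftrightarrow> (\<forall>p\<in>P. v \<bullet> p \<le> v \<bullet> q))"
    by (intro pred_intros_finite pred_intros_logic P ballI) measurable
  then have "{v. \<forall>q\<in>P. q \<in> A \<longleftrightarrow> (\<forall>p\<in>P. v \<bullet> p \<le> v \<bullet> q)} \<in> sets borel"
    by (simp add: pred_def)
  finally show ?thesis .
next
  case False
  then have "exposing_normals P A = {}" by (auto simp: exposing_normals_def)
  then show ?thesis by simp
qed

text \<open>A point \<open>p\<close> of the polytope that maximises \<open>v\<close> is a convex
  combination with weights on \<open>A\<close> only, and \<open>w\<close> is constant on
  \<open>A\<close> because it exposes the same set. Hence \<open>p - a\<close> is orthogonal to the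
  whole cone.\<close>

lemma exposing_normals_inner_eq:
  assumes P: "finite P" and v: "v \<in> exposing_normals P A" and w: "w \<in> exposing_normals P A"
    and a: "a \<in> A" and p: "p \<in> convex hull P" and le: "v \<bullet> a \<le> v \<bullet> p"
  shows "w \<bullet> p = w \<bullet> a"
proof -
  have A: "A = {q \<in> P. \<forall>p\<in>P. v \<bullet> p \<le> v \<bullet> q}" "A = {q \<in> P. \<forall>p\<in>P. w \<bullet> p \<le> w \<bullet> q}"
    using v w by (simp_all add: exposing_normals_def)
  obtain u where u: "\<And>q. q \<in> P \<Longrightarrow> 0 \<le> u q" "sum u P = 1" "(\<Sum>q\<in>P. u q *\<^sub>R q) = p"
    using p by (auto simp: convex_hull_finite[OF P])
  have nonneg: "0 \<le> u q * (v \<bullet> a - v \<bullet> q)" if "q \<in> P" for q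
    using that a A(1) u(1) by (intro mult_nonneg_nonneg) auto
  have "(\<Sum>q\<in>P. u q * (v \<bullet> a - v \<bullet> q)) = v \<bullet> a - v \<bullet> p"
    by (simp add: right_diff_distrib sum_subtractf sum_distrib_right[symmetric] u(2) inner_sum_right u(3)[symmetric])
  also have "\<dots> \<le> 0" using le by simp
  finally have "(\<Sum>q\<in>P. u q * (v \<bullet> a - v \<bullet> q)) = 0"
    using nonneg by (intro antisym sum_nonneg)
  then have zero: "u q * (v \<bullet> a - v \<bullet> q) = 0" if "q \<in> P" for q
    using that P nonneg by (simp add: sum_nonneg_eq_0_iff)
  have "u q * (w \<bullet> q) = u q * (w \<bullet> a)" if q: "q \<in> P" for q
  proof (cases "u q = 0")
    case False
    then have "v \<bullet> q = v \<bullet> a" using zero[OF q] by simp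
    then have "q \<in> A" using q a unfolding A(1) by auto
    then have "w \<bullet> q = w \<bullet> a" using q a unfolding A(2) by (auto intro: antisym)
    then show ?thesis by simp
  qed simp
  then have "(\<Sum>q\<in>P. u q * (w \<bullet> q)) = (\<Sum>q\<in>P. u q * (w \<bullet> a))"
    by (intro sum.cong refl)
  then show ?thesis
    by (simp add: sum_distrib_right[symmetric] u(2) inner_sum_right u(3)[symmetric])
qed

text \<open>The converse of \<open>closest_point_dot\<close>: expanding the square of
  \<open>norm (v - (y - p))\<close> adds only nonnegative terms to that of
  \<open>norm v\<close>.\<close>

lemma closest_point_eqI:
  fixes K :: "'a::euclidean_space set"
  assumes "convex K" "closed K" "p \<in> K" and normal: "\<And>y. y \<in> K \<Longrightarrow> v \<bullet> (y - p) \<le> 0"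
  shows "closest_point K (p + v) = p"
proof (rule closest_point_unique[symmetric, OF assms(1-3)], rule ballI)
  fix y assume "y \<in> K"
  have "(norm v)\<^sup>2 \<le> (norm v)\<^sup>2 - 2 * (v \<bullet> (y - p)) + (norm (y - p))\<^sup>2"
    using normal[OF \<open>y \<in> K\<close>] zero_le_power2[of "norm (y - p)"] by linarith
  also have "\<dots> = (norm (v - (y - p)))\<^sup>2"
    by (simp add: power2_norm_eq_inner inner_diff inner_commute algebra_simps)
  finally have "norm v \<le> norm (v - (y - p))"
    by (simp add: power2_le_iff_abs_le)
  then show "dist (p + v) p \<le> dist (p + v) y"
    by (simp add: dist_norm algebra_simps)
qed

lemma sum_inner_orthonormal:
  assumes "finite B" "pairwise orthogonal B" "\<And>b. b \<in> B \<Longrightarrow> norm b = 1" "b \<in> B"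
  shows "(\<Sum>x\<in>B. t x *\<^sub>R x) \<bullet> b = t b"
proof -
  have "(\<Sum>x\<in>B. t x *\<^sub>R x) \<bullet> b = (\<Sum>x\<in>B. if x = b then t b else 0)"
    unfolding inner_sum_left using assms
    by (intro sum.cong) (auto simp: pairwise_def orthogonal_def norm_eq_1)
  then show ?thesis using assms by simp
qed

lemma orthonormal_expansion:
  assumes "finite B" "pairwise orthogonal B" "\<And>b. b \<in> B \<Longrightarrow> norm b = 1" "v \<in> span B"
  shows "(\<Sum>b\<in>B. (v \<bullet> b) *\<^sub>R b) = v"
  using assms(4)
proof (induction rule: span_induct_alt)
  case base
  then show ?case by simp
next
  case (step c x y)
  have "(\<Sum>b\<in>B. (x \<bullet> b) *\<^sub>R b) = (\<Sum>b\<in>B. if b = x then x else 0)"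
    using assms(1-3) step(1)
    by (intro sum.cong) (auto simp: pairwise_def orthogonal_def norm_eq_1)
  also have "\<dots> = x" using assms(1) step(1) by simp
  finally have "(\<Sum>b\<in>B. (x \<bullet> b) *\<^sub>R b) = x" .
  then show ?case
    using step by (simp add: inner_add_left scaleR_add_left sum.distrib scaleR_sum_right[symmetric] flip: scaleR_scaleR)
qed

section \<open>Volumes of the normal regions and existence of the Steiner coefficients\<close>

context
  fixes P :: "'a::euclidean_space set"
  assumes P: "finite P" "P \<noteq> {}"
begin

private lemma hull: "convex (convex hull P)" "compact (convex hull P)" "closed (convex hull P)" "convex hull P \<noteq> {}"
  using P by (auto simp: finite_imp_compact_convex_hull compact_imp_closed)

lemma sets_normal_region [measurable]: "normal_region P A \<rho> \<in> sets borel"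
proof -
  have [measurable]: "closest_point (convex hull P) \<in> borel_measurable borel"
    by (intro borel_measurable_continuous_onI continuous_on_closest_point hull)
  note sets_exposing_normals[OF P(1), measurable]
  have "exposing_normals P A \<inter> cball 0 \<rho> \<in> sets borel" by simp
  then have "(\<lambda>z. z - closest_point (convex hull P) z) -` (exposing_normals P A \<inter> cball 0 \<rho>) \<in> sets borel"
    by (rule measurable_sets_borel[rotated]) measurable
  then show ?thesis by (simp add: normal_region_def vimage_def)
qed

text \<open>Write a point of the region as \<open>p + v\<close> with \<open>p\<close> its nearest
  point and \<open>v\<close> in the cone. Stretching by \<open>c\<close> about a point of
  \<open>A\<close> along the span of the cone sends it to \<open>p + c *\<^sub>R v\<close>, since
  \<open>p - a\<close> is orthogonal to that span. This carries the region of radius 1 onto that of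
  radius \<open>c\<close>.\<close>

lemma emeasure_normal_region:
  assumes c: "c > 0"
  shows "emeasure lborel (normal_region P A c) =
    ennreal (c ^ dim (exposing_normals P A)) * emeasure lborel (normal_region P A 1)"
proof (cases "exposing_normals P A = {}")
  case True
  then have "normal_region P A \<rho> = {}" for \<rho> by (simp add: normal_region_def)
  then show ?thesis by simp
next
  case False
  let ?K = "convex hull P" and ?C = "exposing_normals P A"
  obtain v0 where "v0 \<in> ?C" using False by blast
  then have A: "A = {q \<in> P. \<forall>p\<in>P. v0 \<bullet> p \<le> v0 \<bullet> q}" by (simp add: exposing_normals_def)
  \<comment> \<open>A finite nonempty \<open>P\<close> has a maximiser of \<open>v0\<close>, so
    \<open>A\<close> is nonempty and supplies the centre \<open>a\<close>.\<close>
  have "Max ((\<bullet>) v0 ` P) \<in> (\<bullet>) v0 ` P" using P by (intro Max_in) auto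
  then obtain a where "a \<in> P" "v0 \<bullet> a = Max ((\<bullet>) v0 ` P)" by auto
  then have a: "a \<in> A" using P by (auto simp: A)
  obtain B where B: "B \<subseteq> span ?C" "pairwise orthogonal B" "\<And>x. x \<in> B \<Longrightarrow> norm x = 1"
     "independent B" "card B = dim (span ?C)" "span B = span ?C"
    using orthonormal_basis_subspace[of "span ?C"] by (auto simp: subspace_span)
  have fB: "finite B" using B(4) by (simp add: independent_imp_finite)
  define T where "T c z = z + (c - 1) *\<^sub>R (\<Sum>b\<in>B. ((z - a) \<bullet> b) *\<^sub>R b)" for c z
  have T: "T c z \<in> normal_region P A (c * \<rho>)" if z: "z \<in> normal_region P A \<rho>" and c: "c > 0" for c z \<rho>
  proof -
    define p where "p = closest_point ?K z"
    define v where "v = z - p"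
    have v: "v \<in> ?C" "norm v \<le> \<rho>" using z by (auto simp: normal_region_def v_def p_def)
    have pK: "p \<in> ?K" unfolding p_def using hull by (intro closest_point_in_set)
    have vp: "v \<bullet> (y - p) \<le> 0" if "y \<in> ?K" for y
      unfolding v_def p_def using hull that by (intro closest_point_dot)
    have "a \<in> ?K" using a A by (auto simp: hull_inc)
    then have le: "v \<bullet> a \<le> v \<bullet> p" using vp[of a] by (simp add: inner_diff_right)
    have "w \<bullet> p = w \<bullet> a" if "w \<in> ?C" for w
      by (rule exposing_normals_inner_eq[OF P(1) v(1) that a pK le])
    then have "orthogonal (p - a) w" if "w \<in> ?C" for w
      using that by (simp add: orthogonal_def inner_diff_right inner_commute[of _ w])
    then have "orthogonal (p - a) b" if "b \<in> B" for b
      using B(1) that by (meson orthogonal_to_span subsetD)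
    then have "(z - a) \<bullet> b = v \<bullet> b" if "b \<in> B" for b
      using that by (simp add: v_def orthogonal_def inner_diff_left)
    then have "(\<Sum>b\<in>B. ((z - a) \<bullet> b) *\<^sub>R b) = (\<Sum>b\<in>B. (v \<bullet> b) *\<^sub>R b)" by simp
    also have "\<dots> = v"
      using B v fB by (intro orthonormal_expansion) (auto simp: span_base)
    finally have sum_v: "(\<Sum>b\<in>B. ((z - a) \<bullet> b) *\<^sub>R b) = v" .
    have Tz: "T c z = p + c *\<^sub>R v"
      unfolding T_def sum_v by (simp add: v_def algebra_simps)
    have "closest_point ?K (T c z) = p"
      unfolding Tz using hull pK vp c by (intro closest_point_eqI) (auto simp: mult_le_0_iff)
    then show ?thesis
      using v c by (simp add: normal_region_def Tz scaleR_in_exposing_normals)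
  qed
  \<comment> \<open>The inverse stretch is needed for the inclusion of the preimage of the region of
    radius \<open>c\<close> in the region of radius 1.\<close>
  have TT: "T (1/c) (T c z) = z" for z
  proof -
    define s where "s = (\<Sum>b\<in>B. ((z - a) \<bullet> b) *\<^sub>R b)"
    have Tz: "T c z = z + (c - 1) *\<^sub>R s" by (simp only: T_def s_def)
    have "(T c z - a) \<bullet> b = c * ((z - a) \<bullet> b)" if "b \<in> B" for b
    proof -
      have sb: "s \<bullet> b = (z - a) \<bullet> b"
        unfolding s_def by (rule sum_inner_orthonormal[OF fB B(2,3) that])
      have "T c z - a = (z - a) + (c - 1) *\<^sub>R s" by (simp add: Tz)
      then show ?thesis by (simp only: inner_add_left inner_scaleR_left sb) (simp add: left_diff_distrib)
    qed
    then have "(\<Sum>b\<in>B. ((T c z - a) \<bullet> b) *\<^sub>R b) = (\<Sum>b\<in>B. c *\<^sub>R (((z - a) \<bullet> b) *\<^sub>R b))"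
      by (intro sum.cong refl) (simp only: scaleR_scaleR)
    also have "\<dots> = c *\<^sub>R s"
      unfolding s_def scaleR_sum_right ..
    finally have eq: "(\<Sum>b\<in>B. ((T c z - a) \<bullet> b) *\<^sub>R b) = c *\<^sub>R s" .
    have "T (1/c) (T c z) = T c z + (1/c - 1) *\<^sub>R c *\<^sub>R s"
      by (subst T_def) (subst eq, rule refl)
    also have "(1/c - 1) *\<^sub>R c *\<^sub>R s = - ((c - 1) *\<^sub>R s)"
      using c by (simp add: algebra_simps)
    finally show ?thesis unfolding Tz by simp
  qed
  have "T c -` normal_region P A c = normal_region P A 1"
  proof (intro set_eqI iffI)
    fix z assume "z \<in> T c -` normal_region P A c"
    then show "z \<in> normal_region P A 1"
      using T[of "T c z" c "1/c"] c by (simp add: TT)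
  next
    fix z assume "z \<in> normal_region P A 1"
    then show "z \<in> T c -` normal_region P A c"
      using T[of z 1 c] c by simp
  qed
  then show ?thesis
    using emeasure_lborel_scale_orthonormal_about[OF fB B(2,3) c sets_normal_region, of A c a]
    by (simp add: T_def[abs_def] B(5))
qed

lemma thickening_eq_normal_regions:
  assumes "\<rho> \<ge> 0"
  shows "convex hull P + cball 0 \<rho> = (\<Union>A\<in>Pow P. normal_region P A \<rho>)"
proof (intro set_eqI iffI)
  let ?K = "convex hull P"
  fix z assume "z \<in> ?K + cball 0 \<rho>"
  then obtain y b where "z = y + b" "y \<in> ?K" "norm b \<le> \<rho>" by (auto elim: set_plus_elim)
  then have "dist z (closest_point ?K z) \<le> \<rho>"
    using closest_point_le[OF hull(3), of y z] by (simp add: dist_norm)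
  \<comment> \<open>The class of \<open>z\<close> is the set of maximisers of its own direction from
    the nearest point.\<close>
  then have "z \<in> normal_region P {q \<in> P. \<forall>p\<in>P. (z - closest_point ?K z) \<bullet> p \<le> (z - closest_point ?K z) \<bullet> q} \<rho>"
    by (simp add: normal_region_def exposing_normals_def dist_norm norm_minus_commute)
  then show "z \<in> (\<Union>A\<in>Pow P. normal_region P A \<rho>)" by (rule UN_I[rotated]) auto
next
  let ?K = "convex hull P"
  fix z assume "z \<in> (\<Union>A\<in>Pow P. normal_region P A \<rho>)"
  then have "z - closest_point ?K z \<in> cball 0 \<rho>" by (auto simp: normal_region_def)
  moreover have "closest_point ?K z \<in> ?K" using hull by (intro closest_point_in_set)
  ultimately have "closest_point ?K z + (z - closest_point ?K z) \<in> ?K + cball 0 \<rho>"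
    by (rule set_plus_intro[rotated])
  then show "z \<in> ?K + cball 0 \<rho>" by simp
qed

lemma disjoint_normal_regions: "disjoint_family_on (\<lambda>A. normal_region P A \<rho>) X"
  by (auto simp: disjoint_family_on_def normal_region_def exposing_normals_def)

lemma emeasure_normal_region_finite: "emeasure lborel (normal_region P A \<rho>) \<noteq> \<infinity>"
proof (cases "\<rho> \<ge> 0 \<and> A \<in> Pow P")
  case True
  then have "normal_region P A \<rho> \<subseteq> convex hull P + cball 0 \<rho>"
    by (auto simp: thickening_eq_normal_regions)
  moreover have "bounded (convex hull P + cball 0 \<rho>)"
    unfolding set_plus_image using hull(2) by (intro bounded_plus compact_imp_bounded compact_cball)
  ultimately have "bounded (normal_region P A \<rho>)" by (rule bounded_subset[rotated])
  then show ?thesis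
    using emeasure_bounded_finite by (auto simp: less_top[symmetric])
next
  case False
  then have "normal_region P A \<rho> = {}"
    by (auto simp: normal_region_def exposing_normals_def intro: order_trans[OF norm_ge_zero])
  then show ?thesis by simp
qed

text \<open>For positive \<open>\<rho>\<close> this is the stretching argument. At
  \<open>\<rho> = 0\<close>, with \<open>0 ^ 0 = 1\<close>, a cone of dimension 0 is unaffected by
  truncation, and for any larger cone the region must be shown to be null.\<close>

lemma measure_normal_region:
  assumes "\<rho> \<ge> 0"
  shows "measure lborel (normal_region P A \<rho>) =
     \<rho> ^ dim (exposing_normals P A) * measure lborel (normal_region P A 1)"
proof (cases "\<rho> > 0")
  case True
  then show ?thesis
    unfolding measure_def by (subst emeasure_normal_region[OF True]) (simp only: enn2real_mult enn2real_ennreal zero_le_power assms)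
next
  case False
  then have [simp]: "\<rho> = 0" using assms by simp
  let ?C = "exposing_normals P A"
  show ?thesis
  proof (cases "dim ?C = 0")
    case True
    then have "?C \<subseteq> {0}" by (simp add: dim_eq_0)
    then have "?C \<inter> cball 0 \<rho> = ?C \<inter> cball 0 1" by auto
    then have "normal_region P A \<rho> = normal_region P A 1" unfolding normal_region_def by simp
    then show ?thesis unfolding True by simp
  next
    case False
    then obtain w where w: "w \<in> ?C" "w \<noteq> 0" by (metis dim_eq_0 insert_iff subsetI)
    \<comment> \<open>If the region has a point, then 0 exposes \<open>A\<close>, so
      \<open>A = P\<close>. The nonzero \<open>w\<close> exposes the same set, hence is constant on
      \<open>P\<close>, and the whole polytope lies in a hyperplane.\<close>
    have "normal_region P A 0 \<subseteq> {x. w \<bullet> x = Max ((\<bullet>) w ` P)}"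
    proof
      fix z assume z: "z \<in> normal_region P A 0"
      then have zero: "0 \<in> ?C" and "z = closest_point (convex hull P) z" by (auto simp: normal_region_def)
      then have zK: "z \<in> convex hull P" using hull by (metis closest_point_in_set)
      have "A = P" using zero by (auto simp: exposing_normals_def)
      have "Max ((\<bullet>) w ` P) \<in> (\<bullet>) w ` P" using P by (intro Max_in) auto
      then obtain a where "a \<in> P" "w \<bullet> a = Max ((\<bullet>) w ` P)" by auto
      then show "z \<in> {x. w \<bullet> x = Max ((\<bullet>) w ` P)}"
        using exposing_normals_inner_eq[OF P(1) zero w(1) _ zK, of a] \<open>A = P\<close> by simp
    qed
    moreover have "negligible {x. w \<bullet> x = Max ((\<bullet>) w ` P)}"
      using w by (intro negligible_hyperplane) auto
    ultimately have "negligible (normal_region P A 0)" by (rule negligible_subset[rotated])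
    then have "measure lebesgue (normal_region P A 0) = 0" by (rule negligible_imp_measure0)
    then show ?thesis using False by (simp add: power_0_left)
  qed
qed

lemma exists_steiner_coefficients: "\<exists>V. steiner_coefficients (convex hull P) V"
proof -
  let ?d = "DIM('a)" and ?k = "\<lambda>A. dim (exposing_normals P A)" and ?m = "\<lambda>A. measure lborel (normal_region P A 1)"
  \<comment> \<open>\<open>V m\<close> collects the classes whose cone has dimension
    \<open>?d - m\<close>, which are those contributing to the power
    \<open>\<rho> ^ (?d - m)\<close>; the division matches the normalisation in Steiner's
    formula.\<close>
  define V where "V m = (\<Sum>A\<in>Pow P. if ?k A = ?d - m then ?m A else 0) / unit_ball_vol (real (?d - m))" for m
  have "measure lborel (convex hull P + (\<lambda>x. \<rho> *\<^sub>R x) ` cball 0 1) =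
        (\<Sum>m=0..?d. \<rho> ^ (?d - m) * unit_ball_vol (real (?d - m)) * V m)" if \<rho>: "\<rho> \<ge> 0" for \<rho>
  proof -
    have "measure lborel (convex hull P + (\<lambda>x. \<rho> *\<^sub>R x) ` cball 0 1) =
        measure lborel (\<Union>A\<in>Pow P. normal_region P A \<rho>)"
      using \<rho> by (simp add: scaleR_image_cball thickening_eq_normal_regions)
    also have "\<dots> = (\<Sum>A\<in>Pow P. measure lborel (normal_region P A \<rho>))"
      using P by (intro measure_finite_Union disjoint_normal_regions emeasure_normal_region_finite) auto
    also have "\<dots> = (\<Sum>A\<in>Pow P. \<rho> ^ ?k A * ?m A)"
      by (intro sum.cong refl measure_normal_region \<rho>)
    \<comment> \<open>Group the classes by the dimension of their cone. The natural subtraction is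
      exact because a dimension is at most \<open>?d\<close>.\<close>
    also have "\<dots> = (\<Sum>A\<in>Pow P. \<Sum>m=0..?d. if m = ?d - ?k A then \<rho> ^ (?d - m) * ?m A else 0)"
      by (intro sum.cong refl) (simp add: dim_subset_UNIV)
    also have "\<dots> = (\<Sum>A\<in>Pow P. \<Sum>m=0..?d. \<rho> ^ (?d - m) * (if ?k A = ?d - m then ?m A else 0))"
      using dim_subset_UNIV[where 'a='a] by (intro sum.cong refl) (auto simp: le_diff_conv)
    also have "\<dots> = (\<Sum>m=0..?d. \<Sum>A\<in>Pow P. \<rho> ^ (?d - m) * (if ?k A = ?d - m then ?m A else 0))"
      by (rule sum.swap)
    also have "\<dots> = (\<Sum>m=0..?d. \<rho> ^ (?d - m) * unit_ball_vol (real (?d - m)) * V m)"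
    proof (intro sum.cong refl)
      fix m
      have "unit_ball_vol (real (?d - m)) \<noteq> 0"
        using unit_ball_vol_pos[of "real (?d - m)"] by linarith
      then show "(\<Sum>A\<in>Pow P. \<rho> ^ (?d - m) * (if ?k A = ?d - m then ?m A else 0)) =
          \<rho> ^ (?d - m) * unit_ball_vol (real (?d - m)) * V m"
        unfolding V_def sum_distrib_left[symmetric] by simp
    qed
    finally show ?thesis .
  qed
  then show ?thesis unfolding steiner_coefficients_def by blast
qed

end

section \<open>The first intrinsic volume of polytopes\<close>

lemma compact_set_plus:
  fixes A B :: "'a::real_normed_vector set"
  assumes "compact A" "compact B"
  shows "compact (A + B)"
  unfolding set_plus_image using assms
  by (intro compact_continuous_image compact_Times) (auto intro!: continuous_intros simp: case_prod_beta)

text \<open>An orthogonal map turning \<open>u\<close> into \<open>norm u *\<^sub>R e\<close>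
  reduces this to a segment along a coordinate axis; it preserves volume, convexity and the ball
  around the origin.\<close>

lemma measure_plus_segment:
  fixes C :: "'a::euclidean_space set"
  assumes C: "compact C" "convex C" "C \<subseteq> cball 0 r" and r: "r > 0"
  shows "measure lborel (C + (\<lambda>s. s *\<^sub>R u) ` {0..1}) \<le>
     measure lborel C + norm u * (unit_ball_vol (real (DIM('a) - 1)) * r ^ (DIM('a) - 1))"
proof -
  obtain e :: 'a where e: "e \<in> Basis" using nonempty_Basis by blast
  obtain f :: "'a \<Rightarrow> 'a" where f: "orthogonal_transformation f" "f u = norm u *\<^sub>R e"
    using orthogonal_transformation_exists_euclidean[of u "norm u *\<^sub>R e"] e by auto
  have lf: "linear f" using f by (simp add: orthogonal_transformation_linear)
  have cf: "continuous_on X f" for X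
    using lf by (intro linear_continuous_on linear_conv_bounded_linear[THEN iffD1])
  have inv: "emeasure lborel (f ` S) = emeasure lborel S" if "compact S" for S
  proof -
    have "compact (f ` S)" using that by (intro compact_continuous_image cf)
    then have "f ` S \<in> sets borel" by (rule borel_compact)
    then have "emeasure (distr lborel borel f) (f ` S) = emeasure lborel (f -` f ` S)"
      using borel_measurable_continuous_onI[OF cf] by (simp add: emeasure_distr)
    then show ?thesis
      using orthogonal_transformation_inj[OF f(1)]
      by (simp add: lborel_distr_orthogonal_transformation[OF f(1)] inj_vimage_image_eq)
  qed
  let ?s = "(\<lambda>s. s *\<^sub>R u) ` {0..1::real}" and ?t = "(\<lambda>s. s *\<^sub>R e) ` {0..norm u}"
  have seg: "f ` ?s = ?t"
  proof -
    have "f ` ?s = (\<lambda>s. s *\<^sub>R e) ` (\<lambda>s. s * norm u) ` {0..1}"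
      by (simp add: image_image linear_scale[OF lf] f(2))
    also have "(\<lambda>s. s * norm u) ` {0..1} = {0..norm u}"
    proof (cases "u = 0")
      case False
      have "x \<in> (\<lambda>s. s * norm u) ` {0..1}" if "x \<in> {0..norm u}" for x
        using that False by (intro image_eqI[of _ _ "x / norm u"]) auto
      then show ?thesis by (auto simp: mult_left_le_one_le)
    qed (auto simp: image_constant_conv)
    finally show ?thesis .
  qed
  have s: "compact ?s"
    by (intro compact_continuous_image continuous_intros) auto
  have plus: "compact (C + ?s)" by (intro compact_set_plus C s)
  have "f ` (C + X) = f ` C + f ` X" for X
    unfolding set_plus_def by (auto simp: linear_add[OF lf]) (auto simp: linear_add[OF lf, symmetric])
  from this[of ?s] have "f ` (C + ?s) = f ` C + ?t" unfolding seg .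
  then have "emeasure lborel (C + ?s) = emeasure lborel (f ` C + ?t)"
    using inv[OF plus] by simp
  also have "\<dots> \<le> emeasure lborel (f ` C) + ennreal (norm u * (unit_ball_vol (real (DIM('a) - 1)) * r ^ (DIM('a) - 1)))"
  proof (rule emeasure_plus_segment_Basis[OF e _ _ _ r])
    show "compact (f ` C)" by (intro compact_continuous_image C cf)
    show "convex (f ` C)" by (intro convex_linear_image lf C)
    show "f ` C \<subseteq> cball 0 r" using C(3) f(1) by (auto simp: orthogonal_transformation_norm)
  qed simp
  also have "emeasure lborel (f ` C) = emeasure lborel C" using inv[OF C(1)] .
  finally have le: "emeasure lborel (C + ?s) \<le> emeasure lborel C + ennreal (norm u * (unit_ball_vol (real (DIM('a) - 1)) * r ^ (DIM('a) - 1)))" .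
  have fin: "emeasure lborel S = ennreal (measure lborel S)" if "compact S" for S :: "'a set"
    using emeasure_compact_finite[OF that] by (intro emeasure_eq_ennreal_measure) simp
  show ?thesis
    using le r unfolding fin[OF plus] fin[OF C(1)]
    by (subst (asm) ennreal_plus[symmetric]) (auto simp del: ennreal_plus)
qed

section \<open>The first intrinsic volume as a limit for large radius\<close>

lemma tendsto_poly_div_power_at_top:
  fixes c :: "nat \<Rightarrow> real"
  shows "((\<lambda>x. (\<Sum>m=0..n. c m * x ^ (n - m)) / x ^ n) \<longlongrightarrow> c 0) at_top"
proof -
  have inv: "((\<lambda>x::real. inverse x) \<longlongrightarrow> 0) at_top" by (rule tendsto_inverse_0_at_top) (rule filterlim_ident)
  have "((\<lambda>x. c m * inverse x ^ m) \<longlongrightarrow> (if m = 0 then c 0 else 0)) at_top" for m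
    using tendsto_mult[OF tendsto_const[of "c m"] tendsto_power[OF inv, of m]]
    by (cases "m = 0") (simp_all add: power_0_left)
  then have "((\<lambda>x. \<Sum>m=0..n. c m * inverse x ^ m) \<longlongrightarrow> (\<Sum>m=0..n. if m = 0 then c 0 else 0)) at_top"
    by (intro tendsto_sum)
  also have "(\<Sum>m=0..n. if m = 0 then c 0 else 0) = c 0" by simp
  finally show ?thesis
  proof (rule Lim_transform_eventually)
    show "\<forall>\<^sub>F x in at_top. (\<Sum>m=0..n. c m * inverse x ^ m) = (\<Sum>m=0..n. c m * x ^ (n - m)) / x ^ n"
      using eventually_gt_at_top[of 0]
    proof eventually_elim
      case (elim x)
      then show ?case
        unfolding sum_divide_distrib by (intro sum.cong refl) (simp add: power_diff field_simps)
    qed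
  qed
qed

text \<open>The leading Steiner coefficient is the volume of the unit ball, so subtracting the
  volume of \<open>cball 0 \<rho>\<close> leaves a polynomial of degree at most
  \<open>DIM('a) - 1\<close>, whose top coefficient is the limit.\<close>

lemma steiner_coefficients_tendsto:
  fixes K :: "'a::euclidean_space set"
  assumes V: "steiner_coefficients K V" and K: "compact K" "K \<noteq> {}"
  shows "((\<lambda>\<rho>. (measure lborel (K + cball 0 \<rho>) - unit_ball_vol DIM('a) * \<rho> ^ DIM('a)) / \<rho> ^ (DIM('a) - 1))
     \<longlongrightarrow> unit_ball_vol (real (DIM('a) - 1)) * V 1) at_top"
proof -
  let ?d = "DIM('a)"
  let ?f = "\<lambda>\<rho>. measure lborel (K + cball 0 \<rho>)"
  define c where "c m = unit_ball_vol (real (?d - m)) * V m" for m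
  have d: "?d = Suc (?d - 1)" by simp
  have f: "?f \<rho> = (\<Sum>m=0..?d. c m * \<rho> ^ (?d - m))" if "\<rho> \<ge> 0" for \<rho>
    using V that by (simp add: steiner_coefficients_def scaleR_image_cball c_def mult_ac)
  obtain R where R: "R > 0" "K \<subseteq> cball 0 R"
    using compact_imp_bounded[OF K(1)] by (metis bounded_pos mem_cball_0 subsetI)
  have "((\<lambda>\<rho>. ?f \<rho> / \<rho> ^ ?d) \<longlongrightarrow> c 0) at_top"
    using tendsto_poly_div_power_at_top[of c ?d]
    by (rule Lim_transform_eventually) (use eventually_ge_at_top[of 0] in eventually_elim, simp only: f)
  moreover have "((\<lambda>\<rho>. ?f \<rho> / \<rho> ^ ?d) \<longlongrightarrow> unit_ball_vol ?d) at_top"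
  \<comment> \<open>The thickened body contains a ball of radius \<open>\<rho>\<close> about a point
    of \<open>K\<close> and is contained in the ball of radius \<open>R + \<rho>\<close> about
    0.\<close>
  proof (rule tendsto_sandwich)
    obtain x where x: "x \<in> K" using K by blast
    have fin: "cball y s \<in> fmeasurable lborel" "K + cball 0 s \<in> fmeasurable lborel" for y :: 'a and s
      using K by (auto intro!: fmeasurable_compact compact_set_plus)
    show "\<forall>\<^sub>F \<rho> in at_top. unit_ball_vol ?d \<le> ?f \<rho> / \<rho> ^ ?d"
      using eventually_gt_at_top[of 0]
    proof eventually_elim
      case (elim \<rho>)
      have "cball x \<rho> \<subseteq> K + cball 0 \<rho>"
      proof
        fix z assume "z \<in> cball x \<rho>"
        then have "x + (z - x) \<in> K + cball 0 \<rho>"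
          using x by (intro set_plus_intro) (auto simp: dist_norm norm_minus_commute)
        then show "z \<in> K + cball 0 \<rho>" by simp
      qed
      then have "measure lborel (cball x \<rho>) \<le> ?f \<rho>"
        using fin by (intro measure_mono_fmeasurable) auto
      then show ?case using elim by (simp add: content_cball field_simps)
    qed
    show "\<forall>\<^sub>F \<rho> in at_top. ?f \<rho> / \<rho> ^ ?d \<le> unit_ball_vol ?d * (R * inverse \<rho> + 1) ^ ?d"
      using eventually_gt_at_top[of 0]
    proof eventually_elim
      case (elim \<rho>)
      have "K + cball 0 \<rho> \<subseteq> cball 0 (R + \<rho>)"
        using R by (auto simp: subset_iff elim!: set_plus_elim intro!: norm_triangle_mono)
      then have "?f \<rho> \<le> measure lborel (cball (0::'a) (R + \<rho>))"
        using fin fin(2)[THEN fmeasurableD] by (intro measure_mono_fmeasurable) auto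
      also have "\<dots> = unit_ball_vol ?d * (R + \<rho>) ^ ?d"
        using elim R by (intro content_cball) simp
      also have "R + \<rho> = (R * inverse \<rho> + 1) * \<rho>"
        using elim by (simp add: distrib_right)
      finally show ?case
        using elim by (simp add: pos_divide_le_eq power_mult_distrib mult.assoc)
    qed
    have "((\<lambda>\<rho>. unit_ball_vol ?d * (R * inverse \<rho> + 1) ^ ?d) \<longlongrightarrow> unit_ball_vol ?d * (R * 0 + 1) ^ ?d) at_top"
      by (intro tendsto_intros tendsto_inverse_0_at_top filterlim_ident)
    then show "((\<lambda>\<rho>. unit_ball_vol ?d * (R * inverse \<rho> + 1) ^ ?d) \<longlongrightarrow> unit_ball_vol ?d) at_top"
      by simp
  qed simp
  ultimately have c0: "c 0 = unit_ball_vol ?d"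
    by (rule tendsto_unique[rotated]) simp
  have "((\<lambda>\<rho>. (?f \<rho> - unit_ball_vol ?d * \<rho> ^ ?d) / \<rho> ^ (?d - 1)) \<longlongrightarrow> c (Suc 0)) at_top"
    using tendsto_poly_div_power_at_top[of "\<lambda>m. c (Suc m)" "?d - 1"]
  proof (rule Lim_transform_eventually)
    show "\<forall>\<^sub>F \<rho> in at_top. (\<Sum>m=0..?d - 1. c (Suc m) * \<rho> ^ (?d - 1 - m)) / \<rho> ^ (?d - 1) =
        (?f \<rho> - unit_ball_vol ?d * \<rho> ^ ?d) / \<rho> ^ (?d - 1)"
      using eventually_ge_at_top[of 0]
    proof eventually_elim
      case (elim \<rho>)
      have "?f \<rho> = (\<Sum>m=0..Suc (?d - 1). c m * \<rho> ^ (?d - m))"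
        using f[OF elim] d by simp
      also have "\<dots> = c 0 * \<rho> ^ ?d + (\<Sum>m=0..?d - 1. c (Suc m) * \<rho> ^ (?d - 1 - m))"
        by (subst sum.atLeast0_atMost_Suc_shift) simp
      finally show ?case by (simp add: c0)
    qed
  qed
  then show ?thesis by (simp add: c_def)
qed

text \<open>Two families of Steiner coefficients have the same limit and hence the same value at 1.
  With existence, this gives the definite description in \<open>intrinsic_volume\<close> its
  value.\<close>

lemma intrinsic_volume_1_tendsto:
  fixes P :: "'a::euclidean_space set"
  assumes P: "finite P" "P \<noteq> {}"
  shows "((\<lambda>\<rho>. (measure lborel (convex hull P + cball 0 \<rho>) - unit_ball_vol DIM('a) * \<rho> ^ DIM('a)) / \<rho> ^ (DIM('a) - 1))
     \<longlongrightarrow> unit_ball_vol (real (DIM('a) - 1)) * intrinsic_volume 1 (convex hull P)) at_top"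
proof -
  let ?K = "convex hull P"
  have K: "compact ?K" "?K \<noteq> {}" using P by (auto simp: finite_imp_compact_convex_hull)
  obtain V where V: "steiner_coefficients ?K V" using exists_steiner_coefficients[OF P] by blast
  have kpos: "unit_ball_vol (real (DIM('a) - 1)) > 0" by (rule unit_ball_vol_pos) simp
  have "V' 1 = V 1" if "steiner_coefficients ?K V'" for V'
    using tendsto_unique[OF _ steiner_coefficients_tendsto[OF that K] steiner_coefficients_tendsto[OF V K]] kpos
    by (metis mult_cancel_left less_irrefl trivial_limit_at_top_linorder)
  then have "intrinsic_volume 1 ?K = V 1"
    unfolding intrinsic_volume_def using V by (intro the_equality) blast+
  then show ?thesis using steiner_coefficients_tendsto[OF V K] by simp
qed

text \<open>Monotonicity and the effect of a segment in one statement. The thickenings are compared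
  by volume: the segment adds at most \<open>norm u\<close> times the volume of a ball of radius
  \<open>R + \<rho>\<close> in dimension \<open>DIM('a) - 1\<close>, and dividing by
  \<open>\<rho> ^ (DIM('a) - 1)\<close> removes \<open>R\<close> in the limit.\<close>

lemma intrinsic_volume_1_le_add_norm:
  fixes P Q :: "'a::euclidean_space set"
  assumes P: "finite P" "P \<noteq> {}" and Q: "finite Q" "Q \<noteq> {}"
    and sub: "Q \<subseteq> convex hull P + (\<lambda>s. s *\<^sub>R u) ` {0..1}"
  shows "intrinsic_volume 1 (convex hull Q) \<le> intrinsic_volume 1 (convex hull P) + norm u"
proof -
  let ?d = "DIM('a)" and ?K = "convex hull P" and ?L = "convex hull Q" and ?s = "(\<lambda>s. s *\<^sub>R u) ` {0..1::real}"
  let ?k = "unit_ball_vol (real (?d - 1))"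
  have kpos: "?k > 0" by (rule unit_ball_vol_pos) simp
  have K: "compact ?K" "compact ?L" using P Q by (auto simp: finite_imp_compact_convex_hull)
  obtain R where R: "R > 0" "?K \<subseteq> cball 0 R"
    using compact_imp_bounded[OF K(1)] by (metis bounded_pos mem_cball_0 subsetI)
  have s: "compact ?s" "convex ?s"
    by (intro compact_continuous_image continuous_intros convex_linear_image linearI; auto simp: algebra_simps)+
  have LK: "?L \<subseteq> ?K + ?s"
    using sub s by (intro hull_minimal convex_set_plus) auto
  have "?k * intrinsic_volume 1 ?L \<le> ?k * intrinsic_volume 1 ?K + norm u * (?k * (R * 0 + 1) ^ (?d - 1))"
  proof (rule tendsto_le)
    show "((\<lambda>\<rho>. (measure lborel (?L + cball 0 \<rho>) - unit_ball_vol ?d * \<rho> ^ ?d) / \<rho> ^ (?d - 1))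
     \<longlongrightarrow> ?k * intrinsic_volume 1 ?L) at_top"
      by (rule intrinsic_volume_1_tendsto[OF Q])
    show "((\<lambda>\<rho>. (measure lborel (?K + cball 0 \<rho>) - unit_ball_vol ?d * \<rho> ^ ?d) / \<rho> ^ (?d - 1) +
         norm u * (?k * (R * inverse \<rho> + 1) ^ (?d - 1)))
     \<longlongrightarrow> ?k * intrinsic_volume 1 ?K + norm u * (?k * (R * 0 + 1) ^ (?d - 1))) at_top"
      by (intro tendsto_add intrinsic_volume_1_tendsto[OF P] tendsto_intros tendsto_inverse_0_at_top filterlim_ident)
    show "\<forall>\<^sub>F \<rho> in at_top. (measure lborel (?L + cball 0 \<rho>) - unit_ball_vol ?d * \<rho> ^ ?d) / \<rho> ^ (?d - 1)
        \<le> (measure lborel (?K + cball 0 \<rho>) - unit_ball_vol ?d * \<rho> ^ ?d) / \<rho> ^ (?d - 1) +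
         norm u * (?k * (R * inverse \<rho> + 1) ^ (?d - 1))"
      using eventually_gt_at_top[of 0]
    proof eventually_elim
      case (elim \<rho>)
      let ?C = "?K + cball 0 \<rho>"
      have C: "compact ?C" "convex ?C" "?C \<subseteq> cball 0 (R + \<rho>)"
        using R K by (auto simp: subset_iff intro!: compact_set_plus convex_set_plus norm_triangle_mono elim!: set_plus_elim)
      have "?L + cball 0 \<rho> \<subseteq> (?K + ?s) + cball 0 \<rho>"
        using LK by (rule set_plus_mono2) simp
      \<comment> \<open>Exchanging the summands makes the segment the last one added, now to the
        convex body \<open>?C\<close>.\<close>
      also have "\<dots> = ?C + ?s" by (simp add: add_ac)
      finally have "measure lborel (?L + cball 0 \<rho>) \<le> measure lborel (?C + ?s)"
        using K C s by (intro measure_mono_fmeasurable fmeasurable_compact compact_set_plus)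
            (auto intro!: borel_compact compact_set_plus)
      also have "\<dots> \<le> measure lborel ?C + norm u * (?k * (R + \<rho>) ^ (?d - 1))"
        using C R elim by (intro measure_plus_segment) auto
      also have "R + \<rho> = (R * inverse \<rho> + 1) * \<rho>" using elim by (simp add: field_simps)
      finally have "measure lborel (?L + cball 0 \<rho>) - unit_ball_vol ?d * \<rho> ^ ?d \<le>
          (measure lborel ?C - unit_ball_vol ?d * \<rho> ^ ?d) + norm u * (?k * (R * inverse \<rho> + 1) ^ (?d - 1)) * \<rho> ^ (?d - 1)"
        by (simp add: power_mult_distrib mult.assoc)
      then have "(measure lborel (?L + cball 0 \<rho>) - unit_ball_vol ?d * \<rho> ^ ?d) / \<rho> ^ (?d - 1) \<le>
          ((measure lborel ?C - unit_ball_vol ?d * \<rho> ^ ?d) + norm u * (?k * (R * inverse \<rho> + 1) ^ (?d - 1)) * \<rho> ^ (?d - 1)) / \<rho> ^ (?d - 1)"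
        using elim by (intro divide_right_mono) auto
      then show ?case using elim by (simp add: add_divide_distrib)
    qed
  qed simp
  then have "?k * intrinsic_volume 1 ?L \<le> ?k * (intrinsic_volume 1 ?K + norm u)"
    by (simp add: algebra_simps)
  then show ?thesis using kpos by simp
qed

section \<open>Variance of Lipschitz functions of independent vectors\<close>

text \<open>The bound makes \<open>F\<close> continuous in the product topology, hence Borel on the
  full function space. It also makes \<open>F\<close> depend only on the coordinates in
  \<open>I\<close>, so composing with the map that sets the others to 0 transfers measurability to
  \<open>Pi\<^sub>M I\<close>.\<close>

lemma borel_measurable_PiM_of_sum_norm_bound:
  fixes F :: "('i::countable \<Rightarrow> 'a::euclidean_space) \<Rightarrow> real"
  assumes F: "\<And>x y. \<bar>F x - F y\<bar> \<le> (\<Sum>i\<in>I. norm (x i - y i))"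
  shows "F \<in> borel_measurable (Pi\<^sub>M I (\<lambda>_. borel))"
proof -
  have "continuous_on UNIV F"
    unfolding continuous_on
  proof
    fix x :: "'i \<Rightarrow> 'a"
    have "((\<lambda>y. \<Sum>i\<in>I. norm (y i - x i)) \<longlongrightarrow> (\<Sum>i\<in>I. norm (x i - x i))) (at x within UNIV)"
    proof (intro tendsto_sum tendsto_norm tendsto_diff tendsto_const)
      fix i
      have "continuous_on UNIV (\<lambda>y::'i \<Rightarrow> 'a. y i)" by (rule continuous_on_product_coordinates)
      then show "((\<lambda>y. y i) \<longlongrightarrow> x i) (at x within UNIV)" by (simp add: continuous_on)
    qed
    then have "((\<lambda>y. \<Sum>i\<in>I. norm (y i - x i)) \<longlongrightarrow> 0) (at x within UNIV)" by simp
    then have "((\<lambda>y. F y - F x) \<longlongrightarrow> 0) (at x within UNIV)"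
      by (rule Lim_null_comparison[rotated]) (auto intro!: always_eventually F)
    then show "(F \<longlongrightarrow> F x) (at x within UNIV)" by (simp add: LIM_zero_iff)
  qed
  then have [measurable]: "F \<in> borel_measurable borel" by (rule borel_measurable_continuous_onI)
  let ?r = "\<lambda>(x::'i \<Rightarrow> 'a) i. if i \<in> I then x i else 0"
  have [measurable]: "?r \<in> borel_measurable (Pi\<^sub>M I (\<lambda>_. borel))"
  proof (rule measurable_coordinatewise_then_product)
    fix i
    show "(\<lambda>x. ?r x i) \<in> borel_measurable (Pi\<^sub>M I (\<lambda>_. borel))"
      by (cases "i \<in> I") simp_all
  qed
  have "F (?r x) = F x" for x
    using F[of "?r x" x] by (simp cong: sum.cong)
  moreover have "(\<lambda>x. F (?r x)) \<in> borel_measurable (Pi\<^sub>M I (\<lambda>_. borel))"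
    by measurable
  ultimately show ?thesis by simp
qed

section \<open>Second moments under product measures\<close>

locale square_integrable_distribution = prob_space N for N :: "'a::euclidean_space measure" +
  assumes sets_N [measurable_cong, simp]: "sets N = sets borel"
    and square_integrable_N: "integrable N (\<lambda>y. (norm y)\<^sup>2)"
begin

lemma integrable_norm_diff_square: "integrable N (\<lambda>y. (norm (y - m))\<^sup>2)"
proof (rule Bochner_Integration.integrable_bound)
  show "integrable N (\<lambda>y. 2 * (norm y)\<^sup>2 + 2 * (norm m)\<^sup>2)"
    using square_integrable_N by simp
  have "(norm (y - m))\<^sup>2 \<le> 2 * (norm y)\<^sup>2 + 2 * (norm m)\<^sup>2" for y
  proof -
    have "(norm (y - m))\<^sup>2 \<le> (norm y + norm m)\<^sup>2" by (intro power_mono norm_triangle_ineq4) simp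
    also have "\<dots> \<le> 2 * (norm y)\<^sup>2 + 2 * (norm m)\<^sup>2"
      using sum_squares_bound[of "norm y" "norm m"] by (simp add: power2_sum)
    finally show ?thesis .
  qed
  then show "AE y in N. norm ((norm (y - m))\<^sup>2) \<le> norm (2 * (norm y)\<^sup>2 + 2 * (norm m)\<^sup>2)" by simp
qed simp

text \<open>The variance of \<open>h\<close> is at most its mean squared deviation from any
  constant. The constant \<open>h m\<close> is chosen because the Lipschitz bound compares that
  deviation with \<open>norm (y - m)\<close>.\<close>

lemma lipschitz_second_moment:
  fixes h :: "'a \<Rightarrow> real"
  assumes h: "\<And>x y. \<bar>h x - h y\<bar> \<le> norm (x - y)"
  shows "integrable N h" and "expectation (\<lambda>y. (h y)\<^sup>2) \<le> (expectation h)\<^sup>2 + expectation (\<lambda>y. (norm (y - m))\<^sup>2)"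
proof -
  have "1-lipschitz_on UNIV h"
    using h by (intro lipschitz_onI) (simp_all add: dist_norm)
  then have "continuous_on UNIV h" by (rule lipschitz_on_continuous_on)
  then have "h \<in> borel_measurable borel" by (rule borel_measurable_continuous_onI)
  then have [measurable]: "h \<in> borel_measurable N" by simp
  have sq: "(h y - h m)\<^sup>2 \<le> (norm (y - m))\<^sup>2" for y
    using h[of y m] by (simp add: abs_le_square_iff[symmetric])
  have int2: "integrable N (\<lambda>y. (h y - h m)\<^sup>2)"
    by (rule Bochner_Integration.integrable_bound[OF integrable_norm_diff_square[of m]]) (simp_all add: sq)
  then have "integrable N (\<lambda>y. h y - h m)"
    by (rule square_integrable_imp_integrable[rotated]) simp
  then have "integrable N (\<lambda>y. (h y - h m) + h m)" by (rule Bochner_Integration.integrable_add) simp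
  then show int: "integrable N h" by simp
  have "(\<lambda>y. (h y)\<^sup>2) = (\<lambda>y. (h y - h m)\<^sup>2 + 2 * h m * h y - (h m)\<^sup>2)"
    by (auto simp: power2_diff)
  then have "expectation (\<lambda>y. (h y)\<^sup>2) = expectation (\<lambda>y. (h y - h m)\<^sup>2 + 2 * h m * h y - (h m)\<^sup>2)" by simp
  also have "\<dots> = expectation (\<lambda>y. (h y - h m)\<^sup>2) + 2 * h m * expectation h - (h m)\<^sup>2"
    using int int2 by (simp add: prob_space)
  also have "\<dots> \<le> expectation (\<lambda>y. (h y - h m)\<^sup>2) + (expectation h)\<^sup>2"
    using zero_le_power2[of "expectation h - h m"] by (simp add: power2_diff algebra_simps)
  also have "expectation (\<lambda>y. (h y - h m)\<^sup>2) \<le> expectation (\<lambda>y. (norm (y - m))\<^sup>2)"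
    by (intro integral_mono int2 integrable_norm_diff_square sq)
  finally show "expectation (\<lambda>y. (h y)\<^sup>2) \<le> (expectation h)\<^sup>2 + expectation (\<lambda>y. (norm (y - m))\<^sup>2)"
    by simp
qed

lemma
  fixes F :: "('i::countable \<Rightarrow> 'a) \<Rightarrow> real"
  assumes I: "finite I" and F: "\<And>x y. \<bar>F x - F y\<bar> \<le> (\<Sum>i\<in>I. norm (x i - y i))"
  shows integrable_PiM_of_sum_norm_bound: "integrable (Pi\<^sub>M I (\<lambda>_. N)) F"
    and square_integrable_PiM_of_sum_norm_bound: "integrable (Pi\<^sub>M I (\<lambda>_. N)) (\<lambda>x. (F x)\<^sup>2)"
proof -
  let ?M = "Pi\<^sub>M I (\<lambda>_. N)"
  interpret M: prob_space ?M by (rule prob_space_PiM) (rule prob_space_axioms)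
  have "F \<in> borel_measurable (Pi\<^sub>M I (\<lambda>_. borel))" by (rule borel_measurable_PiM_of_sum_norm_bound[OF F])
  also have "borel_measurable (Pi\<^sub>M I (\<lambda>_. borel)) = borel_measurable ?M"
    by (intro measurable_cong_sets sets_PiM_cong) simp_all
  finally have [measurable]: "F \<in> borel_measurable ?M" .
  have coord: "integrable ?M (\<lambda>x. (norm (x i))\<^sup>2)" if i: "i \<in> I" for i
  proof -
    have "integrable (distr ?M N (\<lambda>x. x i)) (\<lambda>y. (norm y)\<^sup>2)"
      by (subst distr_PiM_component[OF prob_space_axioms i]) (rule square_integrable_N)
    then show ?thesis using i by (subst (asm) integrable_distr_eq) simp_all
  qed
  show sq: "integrable ?M (\<lambda>x. (F x)\<^sup>2)"
  proof (rule Bochner_Integration.integrable_bound)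
    \<comment> \<open>The bound comes from linear growth of \<open>F\<close> around 0, the square of
      a sum of two terms being at most twice the sum of their squares, and Cauchy-Schwarz for the
      sum of \<open>card I\<close> norms.\<close>
    let ?b = "\<lambda>x. 2 * (F (\<lambda>_. 0))\<^sup>2 + 2 * (real (card I) * (\<Sum>i\<in>I. (norm (x i))\<^sup>2))"
    show "integrable ?M ?b" using coord by simp
    have "(F x)\<^sup>2 \<le> ?b x" for x
    proof -
      let ?s = "\<Sum>i\<in>I. norm (x i)"
      have "\<bar>F x\<bar> \<le> \<bar>F (\<lambda>_. 0)\<bar> + ?s" using F[of x "\<lambda>_. 0"] by simp
      then have "\<bar>F x\<bar>\<^sup>2 \<le> (\<bar>F (\<lambda>_. 0)\<bar> + ?s)\<^sup>2" by (intro power_mono) simp_all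
      also have "\<dots> \<le> 2 * (F (\<lambda>_. 0))\<^sup>2 + 2 * ?s\<^sup>2"
        using sum_squares_bound[of "\<bar>F (\<lambda>_. 0)\<bar>" ?s] by (simp add: power2_sum)
      also have "?s\<^sup>2 \<le> real (card I) * (\<Sum>i\<in>I. (norm (x i))\<^sup>2)"
        using sum_squared_le_sum_of_squares[of "\<lambda>i. norm (x i)" I] by (simp add: mult.commute)
      finally show ?thesis by simp
    qed
    then show "AE x in ?M. norm ((F x)\<^sup>2) \<le> norm (?b x)"
      by (intro AE_I2) (smt (verit) real_norm_def zero_le_power2)
  qed simp
  show "integrable ?M F"
    by (rule M.square_integrable_imp_integrable[OF _ sq]) simp
qed

text \<open>An Efron-Stein type bound by induction on the index set. Stating it with second moments
  instead of variances lets Fubini split off one coordinate directly.\<close>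

lemma second_moment_PiM_of_sum_norm_bound:
  fixes F :: "('i::countable \<Rightarrow> 'a) \<Rightarrow> real"
  assumes "finite I" "\<And>x y. \<bar>F x - F y\<bar> \<le> (\<Sum>i\<in>I. norm (x i - y i))"
  shows "(\<integral>x. (F x)\<^sup>2 \<partial>Pi\<^sub>M I (\<lambda>_. N)) \<le>
    (\<integral>x. F x \<partial>Pi\<^sub>M I (\<lambda>_. N))\<^sup>2 + real (card I) * expectation (\<lambda>y. (norm (y - m))\<^sup>2)"
  using assms
proof (induction I arbitrary: F)
  case empty
  interpret M: prob_space "Pi\<^sub>M {} (\<lambda>_::'i. N)" by (rule prob_space_PiM) (rule prob_space_axioms)
  define c where "c = F (\<lambda>_. 0)"
  have "F x = c" for x using empty(1)[of x "\<lambda>_. 0"] by (simp add: c_def)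
  then show ?case by (simp add: M.prob_space)
next
  case (insert j I F)
  interpret prod: product_sigma_finite "\<lambda>_::'i. N" by standard
  let ?M = "Pi\<^sub>M I (\<lambda>_. N)" and ?s = "expectation (\<lambda>y. (norm (y - m))\<^sup>2)"
  interpret M: prob_space ?M by (rule prob_space_PiM) (rule prob_space_axioms)
  \<comment> \<open>\<open>g\<close> integrates out coordinate \<open>j\<close>: it is the
    conditional expectation of \<open>F\<close> given the others. It inherits the Lipschitz bound
    over \<open>I\<close>, so the induction hypothesis applies to it.\<close>
  define g where "g x = expectation (\<lambda>y. F (x(j := y)))" for x
  have lip: "\<bar>F (x(j := y)) - F (x(j := y'))\<bar> \<le> norm (y - y')" for x y y'
  proof -
    have "(\<Sum>i\<in>I. norm ((x(j := y)) i - (x(j := y')) i)) = 0"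
      using insert.hyps by (intro sum.neutral) auto
    then have "(\<Sum>i\<in>insert j I. norm ((x(j := y)) i - (x(j := y')) i)) = norm (y - y')"
      using insert.hyps by simp
    then show ?thesis using insert.prems[of "x(j := y)" "x(j := y')"] by (simp only:)
  qed
  note h = lipschitz_second_moment[OF lip]
  have g: "\<bar>g x - g x'\<bar> \<le> (\<Sum>i\<in>I. norm (x i - x' i))" for x x'
  proof -
    have le: "\<bar>F (x(j := y)) - F (x'(j := y))\<bar> \<le> (\<Sum>i\<in>I. norm (x i - x' i))" for y
    proof -
      have "\<bar>F (x(j := y)) - F (x'(j := y))\<bar> \<le> (\<Sum>i\<in>insert j I. norm ((x(j := y)) i - (x'(j := y)) i))"
        by (rule insert.prems[of "x(j := y)" "x'(j := y)"])
      also have "\<dots> = (\<Sum>i\<in>I. norm ((x(j := y)) i - (x'(j := y)) i))"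
        using insert.hyps by simp
      also have "\<dots> = (\<Sum>i\<in>I. norm (x i - x' i))"
        using insert.hyps by (intro sum.cong) auto
      finally show ?thesis .
    qed
    have "g x - g x' = expectation (\<lambda>y. F (x(j := y)) - F (x'(j := y)))"
      unfolding g_def using h(1) by simp
    also have "\<bar>\<dots>\<bar> \<le> expectation (\<lambda>y. \<bar>F (x(j := y)) - F (x'(j := y))\<bar>)"
      by (rule integral_abs_bound)
    also have "\<dots> \<le> expectation (\<lambda>y. \<Sum>i\<in>I. norm (x i - x' i))"
      using h(1) le by (intro integral_mono) auto
    finally show ?thesis by (simp add: prob_space)
  qed
  have F1: "(\<integral>x. F x \<partial>Pi\<^sub>M (insert j I) (\<lambda>_. N)) = (\<integral>x. g x \<partial>?M)"
    unfolding g_def using insert.hyps insert.prems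
    by (intro prod.product_integral_insert integrable_PiM_of_sum_norm_bound) auto
  have int: "integrable ?M (\<lambda>x. (g x)\<^sup>2)"
    by (rule square_integrable_PiM_of_sum_norm_bound[OF insert.hyps(1) g])
  have "(\<integral>x. (F x)\<^sup>2 \<partial>Pi\<^sub>M (insert j I) (\<lambda>_. N)) = (\<integral>x. expectation (\<lambda>y. (F (x(j := y)))\<^sup>2) \<partial>?M)"
    using insert.hyps insert.prems
    by (intro prod.product_integral_insert square_integrable_PiM_of_sum_norm_bound) auto
  \<comment> \<open>For fixed \<open>x\<close>, the function of coordinate \<open>j\<close> alone is
    1-Lipschitz with mean \<open>g x\<close>, so the one-variable bound applies under the
    integral.\<close>
  also have "\<dots> \<le> (\<integral>x. (g x)\<^sup>2 + ?s \<partial>?M)"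
  proof (rule integral_mono')
    show "integrable ?M (\<lambda>x. (g x)\<^sup>2 + ?s)" using int by simp
  qed (auto simp: g_def intro!: h(2) add_nonneg_nonneg)
  also have "\<dots> = (\<integral>x. (g x)\<^sup>2 \<partial>?M) + ?s"
    using int by (simp add: M.prob_space)
  also have "(\<integral>x. (g x)\<^sup>2 \<partial>?M) \<le> (\<integral>x. g x \<partial>?M)\<^sup>2 + real (card I) * ?s"
    by (rule insert.IH[OF g])
  finally show ?case
    using insert.hyps by (simp add: F1 algebra_simps)
qed

end

section \<open>Random walks\<close>

text \<open>A function of the deterministic step sequence, so that the bound for product measures
  can be applied. Only the steps 1 to \<open>n\<close> enter.\<close>

definition walk_hull_V1 :: "nat \<Rightarrow> (nat \<Rightarrow> 'a::euclidean_space) \<Rightarrow> real" where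
  "walk_hull_V1 n y = intrinsic_volume 1 (convex hull ((\<lambda>k. \<Sum>i=1..k. y i) ` {0..n}))"

lemma walk_hull_V1_fun_upd: "walk_hull_V1 n (y(j := z)) \<le> walk_hull_V1 n y + norm (z - y j)"
  unfolding walk_hull_V1_def
proof (rule intrinsic_volume_1_le_add_norm)
  let ?P = "(\<lambda>k. \<Sum>i=1..k. y i) ` {0..n}"
  show "(\<lambda>k. \<Sum>i=1..k. (y(j := z)) i) ` {0..n} \<subseteq> convex hull ?P + (\<lambda>s. s *\<^sub>R (z - y j)) ` {0..1}"
  proof (rule image_subsetI)
    fix k assume k: "k \<in> {0..n}"
    \<comment> \<open>The partial sum up to \<open>k\<close> contains step \<open>j\<close> exactly
      when \<open>1 \<le> j \<le> k\<close>. It moves to the far end of the segment in that case and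
      stays put otherwise.\<close>
    let ?s = "if j \<in> {1..k} then 1 else 0 :: real"
    have "(\<Sum>i=1..k. (y(j := z)) i) = (\<Sum>i=1..k. y i + (if i = j then z - y j else 0))"
      by (intro sum.cong) auto
    also have "\<dots> = (\<Sum>i=1..k. y i) + ?s *\<^sub>R (z - y j)"
      by (simp add: sum.distrib)
    also have "\<dots> \<in> convex hull ?P + (\<lambda>s. s *\<^sub>R (z - y j)) ` {0..1}"
      using k by (intro set_plus_intro imageI hull_inc) auto
    finally show "(\<Sum>i=1..k. (y(j := z)) i) \<in> convex hull ?P + (\<lambda>s. s *\<^sub>R (z - y j)) ` {0..1}" .
  qed
qed auto

lemma walk_hull_V1_cong:
  assumes "\<And>i. i \<in> {1..n} \<Longrightarrow> x i = y i"
  shows "walk_hull_V1 n x = walk_hull_V1 n y"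
  unfolding walk_hull_V1_def using assms
  by (intro arg_cong[where f = "\<lambda>P. intrinsic_volume 1 (convex hull P)"] image_cong sum.cong refl) auto

text \<open>The steps of \<open>y\<close> are replaced by those of \<open>x\<close> one at a time,
  each replacement costing the norm of the difference; exchanging the two sequences gives the other
  sign.\<close>

lemma walk_hull_V1_lipschitz:
  "\<bar>walk_hull_V1 n x - walk_hull_V1 n y\<bar> \<le> (\<Sum>i=1..n. norm (x i - y i))"
proof -
  have le: "walk_hull_V1 n x \<le> walk_hull_V1 n y + (\<Sum>i=1..n. norm (x i - y i))" for x y :: "nat \<Rightarrow> 'a"
  proof -
    have "walk_hull_V1 n (\<lambda>i. if i \<in> J then x i else y i) \<le> walk_hull_V1 n y + (\<Sum>i\<in>J. norm (x i - y i))"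
      if "finite J" for J
      using that
    proof (induction J)
      case (insert j J)
      let ?m = "\<lambda>J i. if i \<in> J then x i else y i"
      have "?m (insert j J) = (?m J)(j := x j)" by auto
      then have "walk_hull_V1 n (?m (insert j J)) \<le> walk_hull_V1 n (?m J) + norm (x j - y j)"
        using walk_hull_V1_fun_upd[of n "?m J" j "x j"] insert.hyps by simp
      then show ?case using insert by simp
    qed simp
    from this[of "{1..n}"]
    have "walk_hull_V1 n (\<lambda>i. if i \<in> {1..n} then x i else y i) \<le> walk_hull_V1 n y + (\<Sum>i=1..n. norm (x i - y i))" by simp
    also have "walk_hull_V1 n (\<lambda>i. if i \<in> {1..n} then x i else y i) = walk_hull_V1 n x"
      by (rule walk_hull_V1_cong) simp
    finally show ?thesis .
  qed
  show ?thesis using le[of x y] le[of y x] by (simp add: norm_minus_commute)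
qed

theorem proposition4p4:
  fixes M :: "'w measure"
    and Y :: "nat \<Rightarrow> 'w \<Rightarrow> 'a::euclidean_space"
    and n :: nat
  defines "V1 \<equiv> \<lambda>\<omega>. intrinsic_volume 1 (convex hull ((\<lambda>k. walk Y k \<omega>) ` {0..n}))"
    and "\<mu> \<equiv> prob_space.expectation M (Y 1)"
  assumes "prob_space M"
    and "prob_space.indep_vars M (\<lambda>_. borel) Y {1..}"
    and "\<And>i. i \<ge> 1 \<Longrightarrow> distr M borel (Y i) = distr M borel (Y 1)"
    and "integrable M (\<lambda>\<omega>. (norm (Y 1 \<omega>))\<^sup>2)"
  shows "integrable M V1 \<and> integrable M (\<lambda>\<omega>. (V1 \<omega>)\<^sup>2) \<and>
    prob_space.variance M V1 \<le>
      real n * prob_space.expectation M (\<lambda>\<omega>. (norm (Y 1 \<omega> - \<mu>))\<^sup>2)"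
proof -
  interpret prob_space M by fact
  have Y [measurable]: "Y i \<in> borel_measurable M" if "i \<ge> 1" for i
    using assms(4) that by (auto simp: indep_vars_def)
  let ?N = "distr M borel (Y 1)" and ?X = "\<lambda>\<omega>. \<lambda>i\<in>{1..n}. Y i \<omega>" and ?F = "walk_hull_V1 n :: (nat \<Rightarrow> 'a) \<Rightarrow> real"
  let ?I = "{1..n}"
  have V1: "V1 \<omega> = ?F (?X \<omega>)" for \<omega>
  proof -
    have "V1 \<omega> = ?F (\<lambda>i. Y i \<omega>)" by (simp add: V1_def walk_hull_V1_def walk_def)
    also have "\<dots> = ?F (?X \<omega>)" by (rule walk_hull_V1_cong) simp
    finally show ?thesis .
  qed
  show ?thesis
  proof (cases "n = 0")
    \<comment> \<open>The empty index set is treated apart, since the characterisation of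
      independence by the product distribution is applied for nonempty index sets.\<close>
    case True
    then have "V1 = (\<lambda>_. ?F (\<lambda>_. undefined))" by (simp add: fun_eq_iff V1 restrict_def)
    then show ?thesis using True by (simp add: prob_space)
  next
    case False
    interpret N: square_integrable_distribution ?N
    proof (intro square_integrable_distribution.intro square_integrable_distribution_axioms.intro)
      show "prob_space ?N" by (rule prob_space_distr) simp
    next
      show "integrable ?N (\<lambda>y. (norm y)\<^sup>2)" using assms(6) by (subst integrable_distr_eq) simp_all
    qed simp
    have X [measurable]: "?X \<in> measurable M (Pi\<^sub>M ?I (\<lambda>_. borel))"
      by (intro measurable_restrict Y) simp
    have "indep_vars (\<lambda>_. borel) Y ?I"
      using assms(4) by (rule indep_vars_subset) auto
    \<comment> \<open>Independence makes the joint law of the first \<open>n\<close> steps a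
      product, and equal distribution makes all its factors \<open>?N\<close>.\<close>
    then have "distr M (Pi\<^sub>M ?I (\<lambda>_. borel)) ?X = Pi\<^sub>M ?I (\<lambda>i. distr M borel (Y i))"
      using False Y by (subst (asm) indep_vars_iff_distr_eq_PiM') auto
    also have "\<dots> = Pi\<^sub>M ?I (\<lambda>_. ?N)"
    proof (rule PiM_cong[OF refl])
      fix i assume "i \<in> ?I"
      then have "i \<ge> 1" by simp
      then show "distr M borel (Y i) = ?N" by (rule assms(5))
    qed
    finally have D: "distr M (Pi\<^sub>M ?I (\<lambda>_. borel)) ?X = Pi\<^sub>M ?I (\<lambda>_. ?N)" .
    have lip: "\<bar>?F x - ?F y\<bar> \<le> (\<Sum>i\<in>?I. norm (x i - y i))" for x y
      by (rule walk_hull_V1_lipschitz)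
    have F [measurable]: "?F \<in> borel_measurable (Pi\<^sub>M ?I (\<lambda>_. borel))"
      by (rule borel_measurable_PiM_of_sum_norm_bound[OF lip])
    have F2: "(\<lambda>x. (?F x)\<^sup>2) \<in> borel_measurable (Pi\<^sub>M ?I (\<lambda>_. borel))"
      by measurable
    have int: "integrable M V1"
      using N.integrable_PiM_of_sum_norm_bound[OF finite_atLeastAtMost lip] unfolding D[symmetric] V1[abs_def]
      by (rule integrable_distr[OF X])
    have int2: "integrable M (\<lambda>\<omega>. (V1 \<omega>)\<^sup>2)"
      using N.square_integrable_PiM_of_sum_norm_bound[OF finite_atLeastAtMost lip] unfolding D[symmetric] V1
      by (rule integrable_distr[OF X])
    \<comment> \<open>The second-moment bound is taken with centre \<open>\<mu>\<close> and then
      transferred back to \<open>M\<close>. Subtracting the squared mean turns it into the variance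
      bound.\<close>
    have "(\<integral>x. (?F x)\<^sup>2 \<partial>Pi\<^sub>M ?I (\<lambda>_. ?N)) \<le>
       (\<integral>x. ?F x \<partial>Pi\<^sub>M ?I (\<lambda>_. ?N))\<^sup>2 + real (card ?I) * N.expectation (\<lambda>y. (norm (y - \<mu>))\<^sup>2)"
      by (rule N.second_moment_PiM_of_sum_norm_bound[OF _ lip]) simp
    also have "(\<integral>x. (?F x)\<^sup>2 \<partial>Pi\<^sub>M ?I (\<lambda>_. ?N)) = expectation (\<lambda>\<omega>. (V1 \<omega>)\<^sup>2)"
      unfolding D[symmetric] V1 by (rule integral_distr[OF X F2])
    also have "(\<integral>x. ?F x \<partial>Pi\<^sub>M ?I (\<lambda>_. ?N)) = expectation V1"
      unfolding D[symmetric] V1[abs_def] by (rule integral_distr[OF X F])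
    also have "N.expectation (\<lambda>y. (norm (y - \<mu>))\<^sup>2) = expectation (\<lambda>\<omega>. (norm (Y 1 \<omega> - \<mu>))\<^sup>2)"
      by (rule integral_distr) simp_all
    finally have "variance V1 \<le> real n * expectation (\<lambda>\<omega>. (norm (Y 1 \<omega> - \<mu>))\<^sup>2)"
      using int int2 by (simp add: variance_eq)
    with int int2 show ?thesis by blast
  qed
qed

end
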